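(* Let $(L,T,R)$ be a quantum triad with associated quantales $Q_0=R\otimes_T L$ and $Q_1$. The assignment $$\phi(r\otimes l)=\big(l'\mapsto (l'r)l,\ \ r'\mapsto r(lr')\big)\qquad (r\in R,\ l\in L)$$ determines a unital couple of quantales $Q_0\xrightarrow{\phi}Q_1$. Moreover, a quantale $Q$ is a solution of the triad $(L,T,R)$ (i.e. carries the structure of a solution) if and only if there is a couple factorization $Q_0\xrightarrow{\phi_0}Q\xrightarrow{\phi_1}Q_1$ of $\phi$.
   Context: A sup-lattice is a complete lattice; morphisms of sup-lattices preserve arbitrary joins. A bimorphism $S\times S'\to S''$ is a map that preserves arbitrary joins in each variable separately; its values are written as products. A quantale is a sup-lattice with an associative bimorphism $Q\times Q\to Q$; it is unital if it has a two-sided unit $e$. A quantale morphism is a sup-lattice morphism preserving multiplication. A left $Q$-module is a sup-lattice $M$ with a bimorphism $Q\times M\to M$ satisfying $(qq')m=q(q'm)$, and it is unital if $Q$ is unital and $em=m$; right modules are analogous; a $(Q,Q')$-bimodule is a left $Q$-module and right $Q'$-module with $(qm)q'=q(mq')$. Module and bimodule morphisms are sup-lattice morphisms commuting with the actions. A (quantum) triad $(L,T,R)$ consists of a quantale $T$, a right $T$-module $R$, a left $T$-module $L$, and a bimorphism $L\times R\to T$, $(l,r)\mapsto lr$, such that $(tl)r=t(lr)$ and $(lr)t=l(rt)$ for all $l\in L$, $r\in R$, $t\in T$. A solution of the triad $(L,T,R)$ is a quantale $Q$ together with a left action $Q\times R\to R$ making $R$ a $(Q,T)$-bimodule, a right action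 $L\times Q\to L$ making $L$ a $(T,Q)$-bimodule, and a bimorphism $R\times L\to Q$, $(r,l)\mapsto rl$, such that for all $q\in Q$, $t\in T$, $r,r'\in R$, $l,l'\in L$: $(qr)l=q(rl)$, $(rl)q=r(lq)$, $(rt)l=r(tl)$, $(lq)r=l(qr)$, $(rl)r'=r(lr')$, $(lr)l'=l(rl')$. $Q_0=R\otimes_T L$ is the sup-lattice quotient of the sup-lattice tensor product $R\otimes L$ by the congruence generated by $(rt)\otimes l\sim r\otimes(tl)$, with multiplication $(r\otimes l)(r'\otimes l')=(r(lr'))\otimes l'$. $Q_1$ is the set of pairs $(\alpha,\beta)$ with $\alpha:L\to L$ a left $T$-module morphism, $\beta:R\to R$ a right $T$-module morphism and $\alpha(l)r=l\beta(r)$ for all $l\in L,r\in R$, ordered pointwise, with multiplication $(\alpha,\beta)(\alpha',\beta')=(\alpha'\alpha,\beta\beta')$. It acts by $(\alpha,\beta)r=\beta(r)$ and $l(\alpha,\beta)=\alpha(l)$. $Q_0$ is a $(Q_1,Q_1)$-bimodule by $q(r\otimes l)=(qr)\otimes l$, $(r\otimes l)q=r\otimes(lq)$. A couple of quantales $C\xrightarrow{\phi}Q$ consists of quantales $C,Q$, a $(Q,Q)$-bimodule structure on $C$, and a quantale morphism $\phi:C\to Q$ that is a $(Q,Q)$-bimodule morphism with $cc'=\phi(c)c'=c\phi(c')$ for all $c,c'\in C$ (then $\phi$ is called a coupling map). The couple is unital if $Q$ is unital and $C$ is unital as a left and as a right $Q$-module. A couple factorization of a couple $C\xrightarrow{\phi}Q$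 is a quantale $K$ with quantale morphisms $\phi_0:C\to K$, $\phi_1:K\to Q$ such that $\phi_1\phi_0=\phi$ and $\phi_0$ is a coupling map for the $(K,K)$-bimodule structure on $C$ obtained by restricting scalars along $\phi_1$; namely $\phi_0(\phi_1(k)c)=k\phi_0(c)$ and $\phi_0(c\,\phi_1(k))=\phi_0(c)k$ for all $c\in C$, $k\in K$. *)

theory Defs
  imports "HOL-Algebra.Complete_Lattice" "HOL.Equiv_Relations"
begin

section \<open>Sup-lattices\<close>

text \<open>Sup-lattices are the complete lattices of HOL-Algebra; only the morphisms differ. Joins are
  arbitrary, so the empty join (the bottom element) is preserved as well.\<close>

definition sup_morphism ::
    "('a, 'm) gorder_scheme \<Rightarrow> ('b, 'n) gorder_scheme \<Rightarrow> ('a \<Rightarrow> 'b) \<Rightarrow> bool" where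
  "sup_morphism A B f \<longleftrightarrow> f \<in> carrier A \<rightarrow> carrier B \<and> sup_pres A B f"

definition sup_bimorphism ::
    "('a, 'm) gorder_scheme \<Rightarrow> ('b, 'n) gorder_scheme \<Rightarrow> ('c, 'k) gorder_scheme \<Rightarrow>
     ('a \<Rightarrow> 'b \<Rightarrow> 'c) \<Rightarrow> bool" where
  "sup_bimorphism A B C f \<longleftrightarrow>
     (\<forall>b\<in>carrier B. sup_morphism A C (\<lambda>a. f a b)) \<and>
     (\<forall>a\<in>carrier A. sup_morphism B C (f a))"

definition sup_congruence :: "('a, 'm) gorder_scheme \<Rightarrow> ('a \<times> 'a) set \<Rightarrow> bool" where
  "sup_congruence S \<theta> \<longleftrightarrow>
     equiv (carrier S) \<theta> \<and> (\<forall>P\<subseteq>\<theta>. (\<Squnion>\<^bsub>S\<^esub>(fst ` P), \<Squnion>\<^bsub>S\<^esub>(snd ` P)) \<in> \<theta>)"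

definition generated_congruence ::
    "('a, 'm) gorder_scheme \<Rightarrow> ('a \<times> 'a) set \<Rightarrow> ('a \<times> 'a) set" where
  "generated_congruence S G = \<Inter>{\<theta>. sup_congruence S \<theta> \<and> G \<subseteq> \<theta>}"

text \<open>In the quotient, \<open>[x] \<le> [y]\<close> iff \<open>[x \<squnion> y] = [y]\<close>, that is, iff some representative of
  the first class lies below some representative of the second.\<close>

definition sup_quotient :: "('a, 'm) gorder_scheme \<Rightarrow> ('a \<times> 'a) set \<Rightarrow> 'a set gorder" where
  "sup_quotient S \<theta> =
     \<lparr>carrier = carrier S // \<theta>, eq = (=),
      le = (\<lambda>X Y. \<exists>x\<in>X. \<exists>y\<in>Y. x \<sqsubseteq>\<^bsub>S\<^esub> y)\<rparr>"


section \<open>The tensor product of sup-lattices\<close>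

text \<open>The powerset of \<open>A \<times> B\<close> is the free sup-lattice on \<open>A \<times> B\<close>; the tensor product is its
  quotient by the congruence that makes \<open>(a, b) \<mapsto> {(a, b)}\<close> a bimorphism.\<close>

definition powerset_lattice :: "'a set \<Rightarrow> 'a set gorder" where
  "powerset_lattice X = \<lparr>carrier = Pow X, eq = (=), le = (\<subseteq>)\<rparr>"

definition tensor_congruence ::
    "('a, 'm) gorder_scheme \<Rightarrow> ('b, 'n) gorder_scheme \<Rightarrow> (('a \<times> 'b) set \<times> ('a \<times> 'b) set) set" where
  "tensor_congruence A B =
     generated_congruence (powerset_lattice (carrier A \<times> carrier B))
       ({({(\<Squnion>\<^bsub>A\<^esub>X, b)}, X \<times> {b}) | X b. X \<subseteq> carrier A \<and> b \<in> carrier B} \<union>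
        {({(a, \<Squnion>\<^bsub>B\<^esub>Y)}, {a} \<times> Y) | a Y. a \<in> carrier A \<and> Y \<subseteq> carrier B})"

definition sup_tensor ::
    "('a, 'm) gorder_scheme \<Rightarrow> ('b, 'n) gorder_scheme \<Rightarrow> ('a \<times> 'b) set set gorder" where
  "sup_tensor A B =
     sup_quotient (powerset_lattice (carrier A \<times> carrier B)) (tensor_congruence A B)"

definition pure_tensor ::
    "('a, 'm) gorder_scheme \<Rightarrow> ('b, 'n) gorder_scheme \<Rightarrow> 'a \<Rightarrow> 'b \<Rightarrow> ('a \<times> 'b) set set" where
  "pure_tensor A B a b = tensor_congruence A B `` {{(a, b)}}"


section \<open>Quantales and their modules\<close>

record 'a quantale = "'a gorder" +
  qmult :: "'a \<Rightarrow> 'a \<Rightarrow> 'a"  (infixl "\<cdot>\<index>" 70)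

locale quantale = complete_lattice Q for Q :: "('q, 'm) quantale_scheme" (structure) +
  assumes qmult_bimorphism: "sup_bimorphism Q Q Q (qmult Q)"
    and qmult_assoc:
      "\<lbrakk>x \<in> carrier Q; y \<in> carrier Q; z \<in> carrier Q\<rbrakk> \<Longrightarrow> (x \<cdot> y) \<cdot> z = x \<cdot> (y \<cdot> z)"

definition is_unit :: "('q, 'm) quantale_scheme \<Rightarrow> 'q \<Rightarrow> bool" where
  "is_unit Q e \<longleftrightarrow> e \<in> carrier Q \<and> (\<forall>q\<in>carrier Q. e \<cdot>\<^bsub>Q\<^esub> q = q \<and> q \<cdot>\<^bsub>Q\<^esub> e = q)"

definition quantale_morphism ::
    "('a, 'm) quantale_scheme \<Rightarrow> ('b, 'n) quantale_scheme \<Rightarrow> ('a \<Rightarrow> 'b) \<Rightarrow> bool" where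
  "quantale_morphism A B f \<longleftrightarrow>
     sup_morphism A B f \<and>
     (\<forall>x\<in>carrier A. \<forall>y\<in>carrier A. f (x \<cdot>\<^bsub>A\<^esub> y) = f x \<cdot>\<^bsub>B\<^esub> f y)"

locale left_module = quantale Q + M: complete_lattice M
  for Q :: "('q, 'm) quantale_scheme" (structure) and M :: "('a, 'n) gorder_scheme"
    and la :: "'q \<Rightarrow> 'a \<Rightarrow> 'a" +
  assumes left_action_bimorphism: "sup_bimorphism Q M M la"
    and left_action_assoc:
      "\<lbrakk>p \<in> carrier Q; q \<in> carrier Q; x \<in> carrier M\<rbrakk> \<Longrightarrow> la (p \<cdot> q) x = la p (la q x)"

locale right_module = quantale Q + M: complete_lattice M
  for M :: "('a, 'n) gorder_scheme" and Q :: "('q, 'm) quantale_scheme" (structure)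
    and ra :: "'a \<Rightarrow> 'q \<Rightarrow> 'a" +
  assumes right_action_bimorphism: "sup_bimorphism M Q M ra"
    and right_action_assoc:
      "\<lbrakk>x \<in> carrier M; p \<in> carrier Q; q \<in> carrier Q\<rbrakk> \<Longrightarrow> ra x (p \<cdot> q) = ra (ra x p) q"

locale bimodule = left: left_module Q M la + right: right_module M Q' ra
  for Q :: "('q, 'm) quantale_scheme" and M :: "('a, 'n) gorder_scheme"
    and Q' :: "('p, 'k) quantale_scheme"
    and la :: "'q \<Rightarrow> 'a \<Rightarrow> 'a" and ra :: "'a \<Rightarrow> 'p \<Rightarrow> 'a" +
  assumes actions_commute:
      "\<lbrakk>q \<in> carrier Q; x \<in> carrier M; q' \<in> carrier Q'\<rbrakk> \<Longrightarrow> ra (la q x) q' = la q (ra x q')"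

definition left_module_morphism ::
    "('q, 'm) quantale_scheme \<Rightarrow> ('a, 'n) gorder_scheme \<Rightarrow> ('q \<Rightarrow> 'a \<Rightarrow> 'a) \<Rightarrow>
     ('b, 'k) gorder_scheme \<Rightarrow> ('q \<Rightarrow> 'b \<Rightarrow> 'b) \<Rightarrow> ('a \<Rightarrow> 'b) \<Rightarrow> bool" where
  "left_module_morphism Q M la N la' f \<longleftrightarrow>
     sup_morphism M N f \<and> (\<forall>q\<in>carrier Q. \<forall>x\<in>carrier M. f (la q x) = la' q (f x))"

definition right_module_morphism ::
    "('q, 'm) quantale_scheme \<Rightarrow> ('a, 'n) gorder_scheme \<Rightarrow> ('a \<Rightarrow> 'q \<Rightarrow> 'a) \<Rightarrow>
     ('b, 'k) gorder_scheme \<Rightarrow> ('b \<Rightarrow> 'q \<Rightarrow> 'b) \<Rightarrow> ('a \<Rightarrow> 'b) \<Rightarrow> bool" where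
  "right_module_morphism Q M ra N ra' f \<longleftrightarrow>
     sup_morphism M N f \<and> (\<forall>x\<in>carrier M. \<forall>q\<in>carrier Q. f (ra x q) = ra' (f x) q)"


section \<open>Couples of quantales\<close>

locale couple = C: quantale C + Q: quantale Q + bimodule Q C Q la ra
  for C :: "('c, 'm) quantale_scheme" and Q :: "('q, 'n) quantale_scheme"
    and la :: "'q \<Rightarrow> 'c \<Rightarrow> 'c" and ra :: "'c \<Rightarrow> 'q \<Rightarrow> 'c" and \<phi> :: "'c \<Rightarrow> 'q" +
  assumes coupling_quantale_morphism: "quantale_morphism C Q \<phi>"
    and coupling_left_morphism: "left_module_morphism Q C la Q (qmult Q) \<phi>"
    and coupling_right_morphism: "right_module_morphism Q C ra Q (qmult Q) \<phi>"
    and coupling_left: "\<lbrakk>c \<in> carrier C; c' \<in> carrier C\<rbrakk> \<Longrightarrow> c \<cdot>\<^bsub>C\<^esub> c' = la (\<phi> c) c'"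
    and coupling_right: "\<lbrakk>c \<in> carrier C; c' \<in> carrier C\<rbrakk> \<Longrightarrow> c \<cdot>\<^bsub>C\<^esub> c' = ra c (\<phi> c')"

locale unital_couple = couple C Q la ra \<phi>
  for C :: "('c, 'm) quantale_scheme" and Q :: "('q, 'n) quantale_scheme"
    and la :: "'q \<Rightarrow> 'c \<Rightarrow> 'c" and ra :: "'c \<Rightarrow> 'q \<Rightarrow> 'c" and \<phi> :: "'c \<Rightarrow> 'q" +
  assumes unital: "\<exists>e. is_unit Q e \<and> (\<forall>c\<in>carrier C. la e c = c \<and> ra c e = c)"

text \<open>The last condition says that \<open>\<phi>0\<close> is a coupling map for the \<open>(K, K)\<close>-bimodule structure on
  \<open>C\<close> obtained by restricting scalars along \<open>\<phi>1\<close>.\<close>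

definition couple_factorization ::
    "('c, 'm) quantale_scheme \<Rightarrow> ('q, 'n) quantale_scheme \<Rightarrow> ('q \<Rightarrow> 'c \<Rightarrow> 'c) \<Rightarrow> ('c \<Rightarrow> 'q \<Rightarrow> 'c) \<Rightarrow>
     ('c \<Rightarrow> 'q) \<Rightarrow> ('k, 'l) quantale_scheme \<Rightarrow> ('c \<Rightarrow> 'k) \<Rightarrow> ('k \<Rightarrow> 'q) \<Rightarrow> bool" where
  "couple_factorization C Q la ra \<phi> K \<phi>0 \<phi>1 \<longleftrightarrow>
     quantale K \<and> quantale_morphism C K \<phi>0 \<and> quantale_morphism K Q \<phi>1 \<and>
     (\<forall>c\<in>carrier C. \<phi>1 (\<phi>0 c) = \<phi> c) \<and>
     couple C K (\<lambda>k c. la (\<phi>1 k) c) (\<lambda>c k. ra c (\<phi>1 k)) \<phi>0"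


section \<open>Triads and their solutions\<close>

record ('l, 't, 'r) triad =
  TL :: "'l gorder"
  TT :: "'t quantale"
  TR :: "'r gorder"
  actL :: "'t \<Rightarrow> 'l \<Rightarrow> 'l"
  actR :: "'r \<Rightarrow> 't \<Rightarrow> 'r"
  pairing :: "'l \<Rightarrow> 'r \<Rightarrow> 't"

locale triad =
  L: left_module "TT \<T>" "TL \<T>" "actL \<T>" + R: right_module "TR \<T>" "TT \<T>" "actR \<T>"
  for \<T> :: "('l, 't, 'r) triad" +
  assumes pairing_bimorphism: "sup_bimorphism (TL \<T>) (TR \<T>) (TT \<T>) (pairing \<T>)"
    and pairing_left:
      "\<lbrakk>t \<in> carrier (TT \<T>); l \<in> carrier (TL \<T>); r \<in> carrier (TR \<T>)\<rbrakk> \<Longrightarrow>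
       pairing \<T> (actL \<T> t l) r = t \<cdot>\<^bsub>TT \<T>\<^esub> pairing \<T> l r"
    and pairing_right:
      "\<lbrakk>t \<in> carrier (TT \<T>); l \<in> carrier (TL \<T>); r \<in> carrier (TR \<T>)\<rbrakk> \<Longrightarrow>
       pairing \<T> l r \<cdot>\<^bsub>TT \<T>\<^esub> t = pairing \<T> l (actR \<T> r t)"

text \<open>Below, \<open>la q r\<close> is \<open>q r\<close>, \<open>ra l q\<close> is \<open>l q\<close>, and \<open>rl r l\<close> is the product \<open>r l\<close> in \<open>Q\<close>.\<close>

locale triad_solution = triad \<T> + Q: quantale Q +
  QR: bimodule Q "TR \<T>" "TT \<T>" la "actR \<T>" + LQ: bimodule "TT \<T>" "TL \<T>" Q "actL \<T>" ra
  for \<T> :: "('l, 't, 'r) triad" and Q :: "('q, 'm) quantale_scheme"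
    and la :: "'q \<Rightarrow> 'r \<Rightarrow> 'r" and ra :: "'l \<Rightarrow> 'q \<Rightarrow> 'l" and rl :: "'r \<Rightarrow> 'l \<Rightarrow> 'q" +
  assumes rl_bimorphism: "sup_bimorphism (TR \<T>) (TL \<T>) Q rl"
    and rl_left:
      "\<lbrakk>q \<in> carrier Q; r \<in> carrier (TR \<T>); l \<in> carrier (TL \<T>)\<rbrakk> \<Longrightarrow>
       rl (la q r) l = q \<cdot>\<^bsub>Q\<^esub> rl r l"
    and rl_right:
      "\<lbrakk>q \<in> carrier Q; r \<in> carrier (TR \<T>); l \<in> carrier (TL \<T>)\<rbrakk> \<Longrightarrow>
       rl r l \<cdot>\<^bsub>Q\<^esub> q = rl r (ra l q)"
    and rl_balanced:
      "\<lbrakk>r \<in> carrier (TR \<T>); t \<in> carrier (TT \<T>); l \<in> carrier (TL \<T>)\<rbrakk> \<Longrightarrow>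
       rl (actR \<T> r t) l = rl r (actL \<T> t l)"
    and pairing_balanced:
      "\<lbrakk>l \<in> carrier (TL \<T>); q \<in> carrier Q; r \<in> carrier (TR \<T>)\<rbrakk> \<Longrightarrow>
       pairing \<T> (ra l q) r = pairing \<T> l (la q r)"
    and rl_act_R:
      "\<lbrakk>r \<in> carrier (TR \<T>); l \<in> carrier (TL \<T>); r' \<in> carrier (TR \<T>)\<rbrakk> \<Longrightarrow>
       la (rl r l) r' = actR \<T> r (pairing \<T> l r')"
    and rl_act_L:
      "\<lbrakk>l \<in> carrier (TL \<T>); r \<in> carrier (TR \<T>); l' \<in> carrier (TL \<T>)\<rbrakk> \<Longrightarrow>
       actL \<T> (pairing \<T> l r) l' = ra l (rl r l')"

definition is_triad_solution :: "('l, 't, 'r) triad \<Rightarrow> ('q, 'm) quantale_scheme \<Rightarrow> bool" where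
  "is_triad_solution \<T> Q \<longleftrightarrow> (\<exists>la ra rl. triad_solution \<T> Q la ra rl)"


section \<open>The quantale of balanced tensors\<close>

definition balanced_congruence ::
    "('l, 't, 'r) triad \<Rightarrow> (('r \<times> 'l) set set \<times> ('r \<times> 'l) set set) set" where
  "balanced_congruence \<T> =
     generated_congruence (sup_tensor (TR \<T>) (TL \<T>))
       {(pure_tensor (TR \<T>) (TL \<T>) (actR \<T> r t) l, pure_tensor (TR \<T>) (TL \<T>) r (actL \<T> t l)) | r t l.
          r \<in> carrier (TR \<T>) \<and> t \<in> carrier (TT \<T>) \<and> l \<in> carrier (TL \<T>)}"

definition balanced_tensor :: "('l, 't, 'r) triad \<Rightarrow> ('r \<times> 'l) set set set gorder" where
  "balanced_tensor \<T> = sup_quotient (sup_tensor (TR \<T>) (TL \<T>)) (balanced_congruence \<T>)"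

text \<open>The element \<open>r \<otimes> l\<close> of the balanced tensor product.\<close>

definition pure :: "('l, 't, 'r) triad \<Rightarrow> 'r \<Rightarrow> 'l \<Rightarrow> ('r \<times> 'l) set set set" where
  "pure \<T> r l = balanced_congruence \<T> `` {pure_tensor (TR \<T>) (TL \<T>) r l}"

text \<open>The elements \<open>r \<otimes> l\<close> generate the balanced tensor product under joins, so there is at most
  one bimorphism with the prescribed values on them (up to the irrelevant values outside the
  carriers, hence the choice operator rather than a definite description).  The same
  remark applies to the two actions on the balanced tensor product defined below.\<close>

definition Q0_mult ::
    "('l, 't, 'r) triad \<Rightarrow> ('r \<times> 'l) set set set \<Rightarrow> ('r \<times> 'l) set set set \<Rightarrow> ('r \<times> 'l) set set set" where
  "Q0_mult \<T> =
     (SOME m. sup_bimorphism (balanced_tensor \<T>) (balanced_tensor \<T>) (balanced_tensor \<T>) m \<and>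
        (\<forall>r\<in>carrier (TR \<T>). \<forall>l\<in>carrier (TL \<T>). \<forall>r'\<in>carrier (TR \<T>). \<forall>l'\<in>carrier (TL \<T>).
           m (pure \<T> r l) (pure \<T> r' l') = pure \<T> (actR \<T> r (pairing \<T> l r')) l'))"

definition Q0 :: "('l, 't, 'r) triad \<Rightarrow> ('r \<times> 'l) set set set quantale" where
  "Q0 \<T> = \<lparr>carrier = carrier (balanced_tensor \<T>), eq = (=), le = le (balanced_tensor \<T>),
            qmult = Q0_mult \<T>\<rparr>"


section \<open>The quantale of compatible pairs of endomorphisms\<close>

text \<open>Maps are taken extensional, so that equality of pairs is equality of maps on \<open>L\<close> and \<open>R\<close>.\<close>

definition Q1 :: "('l, 't, 'r) triad \<Rightarrow> (('l \<Rightarrow> 'l) \<times> ('r \<Rightarrow> 'r)) quantale" where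
  "Q1 \<T> =
     \<lparr>carrier = {(\<alpha>, \<beta>).
         \<alpha> \<in> extensional (carrier (TL \<T>)) \<and> \<beta> \<in> extensional (carrier (TR \<T>)) \<and>
         left_module_morphism (TT \<T>) (TL \<T>) (actL \<T>) (TL \<T>) (actL \<T>) \<alpha> \<and>
         right_module_morphism (TT \<T>) (TR \<T>) (actR \<T>) (TR \<T>) (actR \<T>) \<beta> \<and>
         (\<forall>l\<in>carrier (TL \<T>). \<forall>r\<in>carrier (TR \<T>). pairing \<T> (\<alpha> l) r = pairing \<T> l (\<beta> r))},
      eq = (=),
      le = (\<lambda>(\<alpha>, \<beta>) (\<alpha>', \<beta>').
         (\<forall>l\<in>carrier (TL \<T>). \<alpha> l \<sqsubseteq>\<^bsub>TL \<T>\<^esub> \<alpha>' l) \<and> (\<forall>r\<in>carrier (TR \<T>). \<beta> r \<sqsubseteq>\<^bsub>TR \<T>\<^esub> \<beta>' r)),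
      qmult = (\<lambda>(\<alpha>, \<beta>) (\<alpha>', \<beta>').
         (compose (carrier (TL \<T>)) \<alpha>' \<alpha>, compose (carrier (TR \<T>)) \<beta> \<beta>'))\<rparr>"

definition Q1_act_R :: "('l \<Rightarrow> 'l) \<times> ('r \<Rightarrow> 'r) \<Rightarrow> 'r \<Rightarrow> 'r" where
  "Q1_act_R q r = snd q r"

definition Q1_act_L :: "'l \<Rightarrow> ('l \<Rightarrow> 'l) \<times> ('r \<Rightarrow> 'r) \<Rightarrow> 'l" where
  "Q1_act_L l q = fst q l"

definition Q0_left_act ::
    "('l, 't, 'r) triad \<Rightarrow> ('l \<Rightarrow> 'l) \<times> ('r \<Rightarrow> 'r) \<Rightarrow> ('r \<times> 'l) set set set \<Rightarrow> ('r \<times> 'l) set set set" where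
  "Q0_left_act \<T> =
     (SOME a. sup_bimorphism (Q1 \<T>) (Q0 \<T>) (Q0 \<T>) a \<and>
        (\<forall>q\<in>carrier (Q1 \<T>). \<forall>r\<in>carrier (TR \<T>). \<forall>l\<in>carrier (TL \<T>).
           a q (pure \<T> r l) = pure \<T> (Q1_act_R q r) l))"

definition Q0_right_act ::
    "('l, 't, 'r) triad \<Rightarrow> ('r \<times> 'l) set set set \<Rightarrow> ('l \<Rightarrow> 'l) \<times> ('r \<Rightarrow> 'r) \<Rightarrow> ('r \<times> 'l) set set set" where
  "Q0_right_act \<T> =
     (SOME a. sup_bimorphism (Q0 \<T>) (Q1 \<T>) (Q0 \<T>) a \<and>
        (\<forall>r\<in>carrier (TR \<T>). \<forall>l\<in>carrier (TL \<T>). \<forall>q\<in>carrier (Q1 \<T>).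
           a (pure \<T> r l) q = pure \<T> r (Q1_act_L l q)))"

text \<open>\<open>\<phi>\<close> is an extension of
  \<open>r \<otimes> l \<mapsto> (l' \<mapsto> (l' r) l, r' \<mapsto> r (l r'))\<close> to a sup-lattice morphism; extensionality
  only fixes the values outside the carrier.\<close>

definition extends_triad_assignment ::
    "('l, 't, 'r) triad \<Rightarrow> (('r \<times> 'l) set set set \<Rightarrow> ('l \<Rightarrow> 'l) \<times> ('r \<Rightarrow> 'r)) \<Rightarrow> bool" where
  "extends_triad_assignment \<T> \<phi> \<longleftrightarrow>
     \<phi> \<in> extensional (carrier (Q0 \<T>)) \<and> sup_morphism (Q0 \<T>) (Q1 \<T>) \<phi> \<and>
     (\<forall>r\<in>carrier (TR \<T>). \<forall>l\<in>carrier (TL \<T>).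
        \<phi> (pure \<T> r l) =
          (\<lambda>l'\<in>carrier (TL \<T>). actL \<T> (pairing \<T> l' r) l,
           \<lambda>r'\<in>carrier (TR \<T>). actR \<T> r (pairing \<T> l r')))"

end

theory Submission
  imports Defs
begin

text \<open>Everything about \<open>Q\<^sub>0\<close> is read off from its universal property: a balanced bimorphism
  \<open>R \<times> L \<rightarrow> S\<close> extends uniquely to a join-preserving map, and maps that agree on the
  elements \<open>r \<otimes> l\<close> are equal.  This yields \<open>\<phi>\<close> and the two actions of \<open>Q\<^sub>1\<close>, and then the product
  of \<open>Q\<^sub>0\<close> as \<open>c d = \<phi>(c) d\<close>; associativity follows from \<open>\<phi>(q c) = q \<phi>(c)\<close>.  A solution \<open>Q\<close> acts on
  \<open>L\<close> and \<open>R\<close> by compatible pairs, which is a morphism \<open>Q \<rightarrow> Q\<^sub>1\<close>, while \<open>(r, l) \<mapsto> r l\<close> extends to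
  \<open>Q\<^sub>0 \<rightarrow> Q\<close>; conversely a factorization lets \<open>Q\<close> act through \<open>Q\<^sub>1\<close> and gives \<open>r l\<close> as the image of
  \<open>r \<otimes> l\<close>.\<close>

section \<open>Complete lattices and their join-preserving maps\<close>

text \<open>The product of \<open>Q0\<close> and both actions of \<open>Q1\<close> are defined by
  choice, so nothing is known about them until some map with the required values on tensors is
  exhibited. Lifting a product directly would need a universal property in two variables at once.
  Instead the first variable is absorbed by \<open>\<phi>\<close>, whose target \<open>Q1\<close> is
  a complete lattice in its own right; building \<open>\<phi>\<close> and the actions uses only the
  lattice \<open>Q0\<close>, not its product, so there is no circularity. A second obstacle is the
  quotient order, which asks only that some representatives be comparable and is therefore not
  visibly transitive or antisymmetric. Every class of a sup-congruence contains its own join, and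
  this greatest element serves throughout as a canonical representative: it reduces the order, the
  joins and the lifted maps of a quotient to those of the original lattice, with no choice of
  representatives.\<close>

lemma complete_latticeI_sup:
  assumes "partial_order P" "\<And>A. A \<subseteq> carrier P \<Longrightarrow> \<exists>s. least P s (Upper P A)"
  shows "complete_lattice P"
proof -
  interpret partial_order P by fact
  show ?thesis
  proof
    fix A assume A: "A \<subseteq> carrier P"
    show "\<exists>s. least P s (Upper P A)" using A by (rule assms(2))
    \<comment> \<open>The meet of \<open>A\<close> is the join of its lower bounds; every element of
      \<open>A\<close> bounds that set from above, so the join is again a lower bound.\<close>
    obtain s where s: "least P s (Upper P (Lower P A))"
      using assms(2)[of "Lower P A"] by auto
    have "greatest P s (Lower P A)"
    proof (rule greatest_LowerI)
      fix x assume "x \<in> A"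
      then show "s \<sqsubseteq>\<^bsub>P\<^esub> x"
        using s A by (intro least_le[OF s]) (auto simp: Upper_def Lower_def)
    next
      fix y assume "y \<in> Lower P A"
      then show "y \<sqsubseteq>\<^bsub>P\<^esub> s"
        using s by (auto intro: least_Upper_above)
    qed (use A s in auto)
    then show "\<exists>i. greatest P i (Lower P A)" ..
  qed
qed

lemma (in complete_lattice) sup_eqI:
  assumes "A \<subseteq> carrier L" "s \<in> carrier L" "\<And>x. x \<in> A \<Longrightarrow> x \<sqsubseteq> s"
    and "\<And>y. \<lbrakk>y \<in> carrier L; \<And>x. x \<in> A \<Longrightarrow> x \<sqsubseteq> y\<rbrakk> \<Longrightarrow> s \<sqsubseteq> y"
  shows "\<Squnion>A = s"
proof (rule le_antisym)
  show "\<Squnion>A \<sqsubseteq> s" using assms(1-3) by (rule sup_least)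
  show "s \<sqsubseteq> \<Squnion>A" using assms(1) by (intro assms(4)) (auto intro: sup_upper)
qed (use assms in auto)

lemma (in complete_lattice) sup_of_pair:
  assumes "x \<sqsubseteq> y" "x \<in> carrier L" "y \<in> carrier L"
  shows "\<Squnion>{x, y} = y"
  using assms by (intro sup_eqI) auto

lemma (in complete_lattice) sup_Union:
  assumes "\<And>i. i \<in> I \<Longrightarrow> X i \<subseteq> carrier L"
  shows "\<Squnion>(\<Union>i\<in>I. X i) = \<Squnion>((\<lambda>i. \<Squnion>(X i)) ` I)"
proof (rule sup_eqI)
  show "(\<Union>i\<in>I. X i) \<subseteq> carrier L" using assms by auto
  have c: "(\<lambda>i. \<Squnion>(X i)) ` I \<subseteq> carrier L" using assms by auto
  then show "\<Squnion>((\<lambda>i. \<Squnion>(X i)) ` I) \<in> carrier L" by simp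
  show "x \<sqsubseteq> \<Squnion>((\<lambda>i. \<Squnion>(X i)) ` I)" if "x \<in> (\<Union>i\<in>I. X i)" for x
  proof -
    from that obtain i where i: "i \<in> I" "x \<in> X i" by auto
    have "x \<sqsubseteq> \<Squnion>(X i)" using i assms by (auto intro: sup_upper)
    also have "\<Squnion>(X i) \<sqsubseteq> \<Squnion>((\<lambda>i. \<Squnion>(X i)) ` I)" using i c by (auto intro: sup_upper)
    finally show ?thesis using i assms c by (auto simp: subset_iff)
  qed
  show "\<Squnion>((\<lambda>i. \<Squnion>(X i)) ` I) \<sqsubseteq> y"
    if "y \<in> carrier L" "\<And>x. x \<in> (\<Union>i\<in>I. X i) \<Longrightarrow> x \<sqsubseteq> y" for y
    using that assms c by (intro sup_least) (auto intro!: sup_least)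
qed

text \<open>Both iterated joins are the join of the whole doubly indexed family.\<close>

lemma (in complete_lattice) sup_swap:
  assumes "\<And>i j. \<lbrakk>i \<in> I; j \<in> J\<rbrakk> \<Longrightarrow> f i j \<in> carrier L"
  shows "\<Squnion>((\<lambda>i. \<Squnion>((\<lambda>j. f i j) ` J)) ` I) = \<Squnion>((\<lambda>j. \<Squnion>((\<lambda>i. f i j) ` I)) ` J)"
proof -
  have "\<Squnion>((\<lambda>i. \<Squnion>((\<lambda>j. f i j) ` J)) ` I) = \<Squnion>(\<Union>i\<in>I. (\<lambda>j. f i j) ` J)"
    using assms by (intro sup_Union[symmetric]) auto
  also have "(\<Union>i\<in>I. (\<lambda>j. f i j) ` J) = (\<Union>j\<in>J. (\<lambda>i. f i j) ` I)" by auto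
  also have "\<Squnion>\<dots> = \<Squnion>((\<lambda>j. \<Squnion>((\<lambda>i. f i j) ` I)) ` J)"
    using assms by (intro sup_Union) auto
  finally show ?thesis .
qed

section \<open>Join-preserving maps and bimorphisms\<close>

lemma sup_morphismI:
  assumes "complete_lattice A" "complete_lattice B"
    and "\<And>x. x \<in> carrier A \<Longrightarrow> f x \<in> carrier B"
    and "\<And>X. X \<subseteq> carrier A \<Longrightarrow> f (\<Squnion>\<^bsub>A\<^esub>X) = \<Squnion>\<^bsub>B\<^esub>(f ` X)"
  shows "sup_morphism A B f"
  using assms by (auto simp: sup_morphism_def sup_pres_def)

lemma sup_morphism_lattices:
  assumes "sup_morphism A B f"
  shows "complete_lattice A" "complete_lattice B"
  using assms by (auto simp: sup_morphism_def sup_pres_def)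

lemma sup_morphism_closed:
  "\<lbrakk>sup_morphism A B f; x \<in> carrier A\<rbrakk> \<Longrightarrow> f x \<in> carrier B"
  by (auto simp: sup_morphism_def)

lemma sup_morphism_sup:
  "\<lbrakk>sup_morphism A B f; X \<subseteq> carrier A\<rbrakk> \<Longrightarrow> f (\<Squnion>\<^bsub>A\<^esub>X) = \<Squnion>\<^bsub>B\<^esub>(f ` X)"
  by (auto simp: sup_morphism_def sup_pres_def)

text \<open>Only values on the carrier matter. This is what allows a map to be replaced by its
  restriction, as the extensional components of \<open>Q1\<close> and the extensional
  \<open>\<phi>\<close> require.\<close>

lemma sup_morphism_cong:
  assumes "sup_morphism A B f" "\<And>x. x \<in> carrier A \<Longrightarrow> f x = g x"
  shows "sup_morphism A B g"
proof (rule sup_morphismI)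
  interpret A: complete_lattice A using assms by (auto dest: sup_morphism_lattices)
  fix X assume X: "X \<subseteq> carrier A"
  have "g (\<Squnion>\<^bsub>A\<^esub>X) = f (\<Squnion>\<^bsub>A\<^esub>X)" using assms(2) X by simp
  also have "\<dots> = \<Squnion>\<^bsub>B\<^esub>(f ` X)" using sup_morphism_sup[OF assms(1) X] .
  also have "f ` X = g ` X" using X assms(2) by (intro image_cong) auto
  finally show "g (\<Squnion>\<^bsub>A\<^esub>X) = \<Squnion>\<^bsub>B\<^esub>(g ` X)" .
qed (use assms in \<open>auto dest: sup_morphism_lattices sup_morphism_closed\<close>)

lemma sup_morphism_comp:
  assumes "sup_morphism B C g" "sup_morphism A B f"
  shows "sup_morphism A C (\<lambda>x. g (f x))"
proof (rule sup_morphismI)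
  fix X assume X: "X \<subseteq> carrier A"
  then have "f ` X \<subseteq> carrier B" using sup_morphism_closed[OF assms(2)] by auto
  then show "g (f (\<Squnion>\<^bsub>A\<^esub>X)) = \<Squnion>\<^bsub>C\<^esub>((\<lambda>x. g (f x)) ` X)"
    by (simp add: sup_morphism_sup[OF assms(2) X] sup_morphism_sup[OF assms(1)] image_image)
qed (use assms in \<open>auto dest: sup_morphism_lattices sup_morphism_closed\<close>)

text \<open>Interchange of joins. It serves both the joins of \<open>Q1\<close>, which are
  pointwise, and the maps of \<open>Q0\<close> that depend on a parameter.\<close>

lemma sup_morphism_Sup:
  assumes "complete_lattice A" "complete_lattice B" "\<And>i. i \<in> I \<Longrightarrow> sup_morphism A B (f i)"
  shows "sup_morphism A B (\<lambda>x. \<Squnion>\<^bsub>B\<^esub>((\<lambda>i. f i x) ` I))"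
proof (rule sup_morphismI)
  interpret A: complete_lattice A by fact
  interpret B: complete_lattice B by fact
  show "\<Squnion>\<^bsub>B\<^esub>((\<lambda>i. f i x) ` I) \<in> carrier B" if "x \<in> carrier A" for x
    using that sup_morphism_closed[OF assms(3)] by (intro B.sup_closed) auto
  fix X assume X: "X \<subseteq> carrier A"
  have "(\<lambda>i. f i (\<Squnion>\<^bsub>A\<^esub>X)) ` I = (\<lambda>i. \<Squnion>\<^bsub>B\<^esub>((\<lambda>x. f i x) ` X)) ` I"
    using sup_morphism_sup[OF assms(3) X] by (intro image_cong) auto
  also have "\<Squnion>\<^bsub>B\<^esub>\<dots> = \<Squnion>\<^bsub>B\<^esub>((\<lambda>x. \<Squnion>\<^bsub>B\<^esub>((\<lambda>i. f i x) ` I)) ` X)"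
    using X sup_morphism_closed[OF assms(3)] by (intro B.sup_swap) auto
  finally show "\<Squnion>\<^bsub>B\<^esub>((\<lambda>i. f i (\<Squnion>\<^bsub>A\<^esub>X)) ` I) = \<Squnion>\<^bsub>B\<^esub>((\<lambda>x. \<Squnion>\<^bsub>B\<^esub>((\<lambda>i. f i x) ` I)) ` X)" .
qed fact+

lemma sup_morphism_id: "complete_lattice A \<Longrightarrow> sup_morphism A A (\<lambda>x. x)"
  by (rule sup_morphismI) auto

lemma sup_bimorphismI:
  assumes "\<And>b. b \<in> carrier B \<Longrightarrow> sup_morphism A C (\<lambda>a. f a b)"
    and "\<And>a. a \<in> carrier A \<Longrightarrow> sup_morphism B C (\<lambda>b. f a b)"
  shows "sup_bimorphism A B C f"
  using assms by (auto simp: sup_bimorphism_def)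

lemma sup_bimorphism_left:
  "\<lbrakk>sup_bimorphism A B C f; b \<in> carrier B\<rbrakk> \<Longrightarrow> sup_morphism A C (\<lambda>a. f a b)"
  by (simp add: sup_bimorphism_def)

lemma sup_bimorphism_right:
  "\<lbrakk>sup_bimorphism A B C f; a \<in> carrier A\<rbrakk> \<Longrightarrow> sup_morphism B C (\<lambda>b. f a b)"
  by (simp add: sup_bimorphism_def)

lemma sup_bimorphism_closed:
  "\<lbrakk>sup_bimorphism A B C f; a \<in> carrier A; b \<in> carrier B\<rbrakk> \<Longrightarrow> f a b \<in> carrier C"
  by (rule sup_morphism_closed[OF sup_bimorphism_right])

lemma sup_bimorphism_comp:
  assumes g: "sup_morphism C D g" and f: "sup_bimorphism A B C f"
  shows "sup_bimorphism A B D (\<lambda>a b. g (f a b))"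
proof (rule sup_bimorphismI)
  show "sup_morphism A D (\<lambda>a. g (f a b))" if "b \<in> carrier B" for b
    by (rule sup_morphism_comp[OF g sup_bimorphism_left[OF f that]])
  show "sup_morphism B D (\<lambda>b. g (f a b))" if "a \<in> carrier A" for a
    by (rule sup_morphism_comp[OF g sup_bimorphism_right[OF f that]])
qed

lemma sup_bimorphism_comp_args:
  assumes "sup_bimorphism A B C f" "sup_morphism A' A g" "sup_morphism B' B h"
  shows "sup_bimorphism A' B' C (\<lambda>a b. f (g a) (h b))"
proof (rule sup_bimorphismI)
  fix b assume "b \<in> carrier B'"
  then have "h b \<in> carrier B" using assms(3) by (rule sup_morphism_closed[rotated])
  then show "sup_morphism A' C (\<lambda>a. f (g a) (h b))"
    by (rule sup_morphism_comp[OF sup_bimorphism_left[OF assms(1)] assms(2)])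
next
  fix a assume "a \<in> carrier A'"
  then have "g a \<in> carrier A" using assms(2) by (rule sup_morphism_closed[rotated])
  then show "sup_morphism B' C (\<lambda>b. f (g a) (h b))"
    by (rule sup_morphism_comp[OF sup_bimorphism_right[OF assms(1)] assms(3)])
qed

section \<open>Quotients by sup-lattice congruences\<close>

lemma sup_quotient_simps [simp]:
  "carrier (sup_quotient S \<theta>) = carrier S // \<theta>"
  "eq (sup_quotient S \<theta>) = (=)"
  "le (sup_quotient S \<theta>) = (\<lambda>X Y. \<exists>x\<in>X. \<exists>y\<in>Y. x \<sqsubseteq>\<^bsub>S\<^esub> y)"
  by (simp_all add: sup_quotient_def)

locale sup_lattice_congruence = complete_lattice S for S (structure) +
  fixes \<theta>
  assumes sup_congruence: "sup_congruence S \<theta>"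
begin

lemma equivalence: "equiv (carrier S) \<theta>"
  using sup_congruence by (simp add: sup_congruence_def)

lemma related_closed: "(x, y) \<in> \<theta> \<Longrightarrow> x \<in> carrier S" "(x, y) \<in> \<theta> \<Longrightarrow> y \<in> carrier S"
  using equivalence by (auto simp: equiv_def)

lemma class_subset: "X \<in> carrier S // \<theta> \<Longrightarrow> X \<subseteq> carrier S"
  using equivalence by (auto simp: quotient_def related_closed)

lemma sup_related:
  assumes "\<And>i. i \<in> I \<Longrightarrow> (f i, g i) \<in> \<theta>"
  shows "(\<Squnion>(f ` I), \<Squnion>(g ` I)) \<in> \<theta>"
proof -
  have "(\<lambda>i. (f i, g i)) ` I \<subseteq> \<theta>" using assms by auto
  then have "(\<Squnion>(fst ` (\<lambda>i. (f i, g i)) ` I), \<Squnion>(snd ` (\<lambda>i. (f i, g i)) ` I)) \<in> \<theta>"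
    using sup_congruence unfolding sup_congruence_def by blast
  then show ?thesis by (simp add: image_image)
qed

text \<open>Relate the family of all members of the class to the constant family at a representative
  \<open>x\<close>. The class is nonempty, so the constant family has join \<open>x\<close>, and the
  join of the class is therefore related to \<open>x\<close>.\<close>

lemma sup_class_mem:
  assumes "X \<in> carrier S // \<theta>"
  shows "\<Squnion>X \<in> X"
proof -
  obtain x where x: "x \<in> carrier S" "X = \<theta> `` {x}" using assms by (auto elim: quotientE)
  have "(\<Squnion>((\<lambda>_. x) ` X), \<Squnion>((\<lambda>y. y) ` X)) \<in> \<theta>"
    by (rule sup_related) (auto simp: x)
  moreover have "(\<lambda>_. x) ` X = {x}"
    using x equiv_class_self[OF equivalence] by auto
  ultimately show ?thesis using x by simp
qed

lemma class_of_mem: "\<lbrakk>X \<in> carrier S // \<theta>; x \<in> X\<rbrakk> \<Longrightarrow> \<theta> `` {x} = X"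
  using equivalence by (metis Image_singleton_iff equiv_class_eq quotientE)

text \<open>Each class has a greatest element, and comparing classes amounts to comparing these.\<close>

lemma quotient_le_iff:
  assumes X: "X \<in> carrier S // \<theta>" and Y: "Y \<in> carrier S // \<theta>"
  shows "X \<sqsubseteq>\<^bsub>sup_quotient S \<theta>\<^esub> Y \<longleftrightarrow> \<Squnion>X \<sqsubseteq> \<Squnion>Y"
proof
  assume "X \<sqsubseteq>\<^bsub>sup_quotient S \<theta>\<^esub> Y"
  then obtain x y where xy: "x \<in> X" "y \<in> Y" "x \<sqsubseteq> y" by auto
  note sub = class_subset[OF X] class_subset[OF Y]
  have "(x, \<Squnion>X) \<in> \<theta>" using class_of_mem[OF X xy(1)] sup_class_mem[OF X] by auto
  moreover have "(y, y) \<in> \<theta>" using class_of_mem[OF Y xy(2)] xy(2) by auto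
  \<comment> \<open>Joining the related pairs \<open>(x, \<Squnion>X)\<close> and
    \<open>(y, y)\<close>, written as a family indexed by the booleans, shows that
    \<open>\<Squnion>{\<Squnion>X, y}\<close> is related to \<open>\<Squnion>{x, y} = y\<close>. It
    thus lies in \<open>Y\<close>, and so below \<open>\<Squnion>Y\<close>.\<close>
  ultimately have "(\<Squnion>((\<lambda>b. if b then x else y) ` UNIV), \<Squnion>((\<lambda>b. if b then \<Squnion>X else y) ` UNIV)) \<in> \<theta>"
    by (intro sup_related) auto
  then have "(\<Squnion>{x, y}, \<Squnion>{\<Squnion>X, y}) \<in> \<theta>"
    by (simp add: UNIV_bool insert_commute)
  moreover have "\<Squnion>{x, y} = y" using xy sub by (intro sup_of_pair) auto
  ultimately have "\<Squnion>{\<Squnion>X, y} \<in> Y" using class_of_mem[OF Y xy(2)] by auto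
  then have "\<Squnion>{\<Squnion>X, y} \<sqsubseteq> \<Squnion>Y" using sub by (intro sup_upper)
  moreover have "\<Squnion>X \<sqsubseteq> \<Squnion>{\<Squnion>X, y}" using sub xy by (intro sup_upper) auto
  ultimately show "\<Squnion>X \<sqsubseteq> \<Squnion>Y"
    using le_trans[of "\<Squnion>X" "\<Squnion>{\<Squnion>X, y}" "\<Squnion>Y"] sub xy by (auto simp: subset_iff)
next
  assume "\<Squnion>X \<sqsubseteq> \<Squnion>Y"
  then show "X \<sqsubseteq>\<^bsub>sup_quotient S \<theta>\<^esub> Y" using sup_class_mem X Y by auto
qed

text \<open>The order is pulled back from \<open>S\<close> along the map taking a class to its join;
  this map is injective because a class is recovered as the class of its join.\<close>

lemma quotient_partial_order: "partial_order (sup_quotient S \<theta>)"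
proof
  fix X Y assume XY: "X \<in> carrier (sup_quotient S \<theta>)" "Y \<in> carrier (sup_quotient S \<theta>)"
    and le: "X \<sqsubseteq>\<^bsub>sup_quotient S \<theta>\<^esub> Y" "Y \<sqsubseteq>\<^bsub>sup_quotient S \<theta>\<^esub> X"
  then have "\<Squnion>X \<sqsubseteq> \<Squnion>Y" "\<Squnion>Y \<sqsubseteq> \<Squnion>X"
    using quotient_le_iff[of X Y] quotient_le_iff[of Y X] by auto
  then have "\<Squnion>X = \<Squnion>Y" using XY by (auto intro!: le_antisym dest: class_subset)
  then have "\<theta> `` {\<Squnion>X} = \<theta> `` {\<Squnion>Y}" by (rule arg_cong)
  moreover have "\<theta> `` {\<Squnion>X} = X" "\<theta> `` {\<Squnion>Y} = Y"
    using XY by (auto intro!: class_of_mem sup_class_mem)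
  ultimately show "X .=\<^bsub>sup_quotient S \<theta>\<^esub> Y" by simp
next
  fix X assume "X \<in> carrier (sup_quotient S \<theta>)"
  then show "X \<sqsubseteq>\<^bsub>sup_quotient S \<theta>\<^esub> X"
    using quotient_le_iff[of X X] class_subset[of X] by simp
next
  fix X Y Z assume XYZ: "X \<in> carrier (sup_quotient S \<theta>)" "Y \<in> carrier (sup_quotient S \<theta>)"
    "Z \<in> carrier (sup_quotient S \<theta>)"
    and "X \<sqsubseteq>\<^bsub>sup_quotient S \<theta>\<^esub> Y" "Y \<sqsubseteq>\<^bsub>sup_quotient S \<theta>\<^esub> Z"
  then have "\<Squnion>X \<sqsubseteq> \<Squnion>Y" "\<Squnion>Y \<sqsubseteq> \<Squnion>Z"
    using quotient_le_iff[of X Y] quotient_le_iff[of Y Z] by auto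
  then have "\<Squnion>X \<sqsubseteq> \<Squnion>Z"
    using XYZ le_trans[of "\<Squnion>X" "\<Squnion>Y" "\<Squnion>Z"] class_subset by simp
  then show "X \<sqsubseteq>\<^bsub>sup_quotient S \<theta>\<^esub> Z"
    using XYZ quotient_le_iff[of X Z] by simp
qed auto

lemma class_closed: "x \<in> carrier S \<Longrightarrow> \<theta> `` {x} \<in> carrier S // \<theta>"
  by (rule quotientI)

text \<open>The candidate joins the greatest elements of the classes in \<open>F\<close>. If
  \<open>Y\<close> is an upper bound, each of these lies below \<open>\<Squnion>Y\<close>, hence so
  does their join, and \<open>\<Squnion>Y\<close> belongs to \<open>Y\<close>.\<close>

lemma quotient_least:
  assumes F: "F \<subseteq> carrier (sup_quotient S \<theta>)"
  shows "least (sup_quotient S \<theta>) (\<theta> `` {\<Squnion>(Lattice.sup S ` F)}) (Upper (sup_quotient S \<theta>) F)"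
proof (rule least_UpperI)
  let ?x = "\<Squnion>(Lattice.sup S ` F)"
  have sub: "Lattice.sup S ` F \<subseteq> carrier S" using F class_subset by auto
  then have x: "?x \<in> carrier S" by simp
  show "X \<sqsubseteq>\<^bsub>sup_quotient S \<theta>\<^esub> \<theta> `` {?x}" if "X \<in> F" for X
  proof -
    have "\<Squnion>X \<in> X" using that F sup_class_mem by auto
    moreover have "\<Squnion>X \<sqsubseteq> ?x" using sub that by (auto intro: sup_upper)
    moreover have "?x \<in> \<theta> `` {?x}" using x equivalence by (rule equiv_class_self[rotated])
    ultimately show ?thesis by (simp only: sup_quotient_simps) blast
  qed
  show "\<theta> `` {?x} \<sqsubseteq>\<^bsub>sup_quotient S \<theta>\<^esub> Y" if Y: "Y \<in> Upper (sup_quotient S \<theta>) F" for Y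
  proof -
    have Yc: "Y \<in> carrier S // \<theta>" using Y by (auto simp: Upper_def)
    have "\<Squnion>X \<sqsubseteq> \<Squnion>Y" if "X \<in> F" for X
      using that F Yc Y quotient_le_iff[of X Y] by (auto simp: Upper_def)
    then have "?x \<sqsubseteq> \<Squnion>Y"
      using sub Yc class_subset by (intro sup_least) auto
    moreover have "?x \<in> \<theta> `` {?x}" using x equivalence by (rule equiv_class_self[rotated])
    ultimately show ?thesis using sup_class_mem[OF Yc] by auto
  qed
  show "F \<subseteq> carrier (sup_quotient S \<theta>)" by fact
  show "\<theta> `` {?x} \<in> carrier (sup_quotient S \<theta>)" using x by (simp add: class_closed)
qed

lemma quotient_complete_lattice: "complete_lattice (sup_quotient S \<theta>)"
proof (rule complete_latticeI_sup[OF quotient_partial_order])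
  fix F assume "F \<subseteq> carrier (sup_quotient S \<theta>)"
  then show "\<exists>X. least (sup_quotient S \<theta>) X (Upper (sup_quotient S \<theta>) F)"
    by (intro exI) (rule quotient_least)
qed

lemma quotient_sup:
  assumes "F \<subseteq> carrier S // \<theta>"
  shows "\<Squnion>\<^bsub>sup_quotient S \<theta>\<^esub>F = \<theta> `` {\<Squnion>(Lattice.sup S ` F)}"
proof -
  interpret quot: complete_lattice "sup_quotient S \<theta>" by (rule quotient_complete_lattice)
  have F: "F \<subseteq> carrier (sup_quotient S \<theta>)" using assms by simp
  show ?thesis by (rule quot.least_unique[OF quot.sup_lub[OF F] quotient_least[OF F]])
qed

lemma sup_class_related: "x \<in> carrier S \<Longrightarrow> (x, \<Squnion>(\<theta> `` {x})) \<in> \<theta>"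
  using sup_class_mem[OF class_closed] by auto

lemma projection_sup_morphism: "sup_morphism S (sup_quotient S \<theta>) (\<lambda>x. \<theta> `` {x})"
proof (rule sup_morphismI)
  show "complete_lattice S" ..
  show "complete_lattice (sup_quotient S \<theta>)" by (rule quotient_complete_lattice)
  show "\<theta> `` {x} \<in> carrier (sup_quotient S \<theta>)" if "x \<in> carrier S" for x
    using that by (simp add: class_closed)
  fix X assume X: "X \<subseteq> carrier S"
  \<comment> \<open>Joins in the quotient are computed from greatest elements, so each
    \<open>x\<close> is compared with the greatest element of its own class; the congruence carries
    these relations over to the joins.\<close>
  have "(\<Squnion>((\<lambda>x. x) ` X), \<Squnion>((\<lambda>x. \<Squnion>(\<theta> `` {x})) ` X)) \<in> \<theta>"
    using X by (intro sup_related) (auto intro: sup_class_related)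
  then have "\<theta> `` {\<Squnion>X} = \<theta> `` {\<Squnion>((\<lambda>x. \<Squnion>(\<theta> `` {x})) ` X)}"
    using equiv_class_eq[OF equivalence] by simp
  also have "\<dots> = \<Squnion>\<^bsub>sup_quotient S \<theta>\<^esub>((\<lambda>x. \<theta> `` {x}) ` X)"
    using X by (subst quotient_sup) (auto simp: image_image class_closed)
  finally show "\<theta> `` {\<Squnion>X} = \<Squnion>\<^bsub>sup_quotient S \<theta>\<^esub>((\<lambda>x. \<theta> `` {x}) ` X)" .
qed

text \<open>The lift evaluates \<open>f\<close> at the greatest element of a class, which is well
  defined without choice and gives the expected value since \<open>f\<close> is constant on
  classes.\<close>

lemma quotient_lift:
  assumes f: "sup_morphism S B f" and resp: "\<And>x y. (x, y) \<in> \<theta> \<Longrightarrow> f x = f y"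
  shows "\<exists>g. sup_morphism (sup_quotient S \<theta>) B g \<and> (\<forall>x\<in>carrier S. g (\<theta> `` {x}) = f x)"
proof (intro exI conjI ballI)
  show eq: "f (\<Squnion>(\<theta> `` {x})) = f x" if "x \<in> carrier S" for x
    using resp[OF sup_class_related[OF that]] by simp
  show "sup_morphism (sup_quotient S \<theta>) B (\<lambda>X. f (\<Squnion>X))"
  proof (rule sup_morphismI)
    show "complete_lattice (sup_quotient S \<theta>)" by (rule quotient_complete_lattice)
    show "complete_lattice B" using f by (rule sup_morphism_lattices)
    show "f (\<Squnion>X) \<in> carrier B" if "X \<in> carrier (sup_quotient S \<theta>)" for X
      using that class_subset by (intro sup_morphism_closed[OF f]) auto
    fix F assume F: "F \<subseteq> carrier (sup_quotient S \<theta>)"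
    then have sub: "Lattice.sup S ` F \<subseteq> carrier S" using class_subset by auto
    have "f (\<Squnion>(\<Squnion>\<^bsub>sup_quotient S \<theta>\<^esub>F)) = f (\<Squnion>(Lattice.sup S ` F))"
      using F sub by (simp add: quotient_sup eq)
    also have "\<dots> = \<Squnion>\<^bsub>B\<^esub>(f ` Lattice.sup S ` F)" using f sub by (rule sup_morphism_sup)
    finally show "f (\<Squnion>(\<Squnion>\<^bsub>sup_quotient S \<theta>\<^esub>F)) = \<Squnion>\<^bsub>B\<^esub>((\<lambda>X. f (\<Squnion>X)) ` F)"
      by (simp add: image_image)
  qed
qed

end

section \<open>Generated congruences and kernels\<close>

lemma total_sup_congruence:
  assumes "complete_lattice S"
  shows "sup_congruence S (carrier S \<times> carrier S)"
proof -
  interpret complete_lattice S by fact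
  have "equiv (carrier S) (carrier S \<times> carrier S)"
    by (auto simp: equiv_def refl_on_def sym_def trans_def)
  then show ?thesis
    by (fastforce simp: sup_congruence_def intro!: sup_closed)
qed

lemma generated_sup_congruence:
  assumes "complete_lattice S" "G \<subseteq> carrier S \<times> carrier S"
  shows "sup_lattice_congruence S (generated_congruence S G)"
proof -
  interpret complete_lattice S by fact
  let ?C = "{\<theta>. sup_congruence S \<theta> \<and> G \<subseteq> \<theta>}"
  \<comment> \<open>The total relation makes the intersection range over a nonempty family, which
    keeps it inside the carrier.\<close>
  have ne: "carrier S \<times> carrier S \<in> ?C" using total_sup_congruence assms by auto
  have eqv: "equiv (carrier S) \<theta>" if "\<theta> \<in> ?C" for \<theta>
    using that by (simp add: sup_congruence_def)
  have "equiv (carrier S) (\<Inter>?C)"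
  proof (rule equivI)
    show "\<Inter>?C \<subseteq> carrier S \<times> carrier S" using ne by blast
    show "refl_on (carrier S) (\<Inter>?C)"
      using eqv by (simp add: refl_on_def equiv_def)
    show "sym (\<Inter>?C)" using eqv by (intro symI InterI) (metis InterD equiv_def symE)
    show "trans (\<Inter>?C)" using eqv by (intro transI InterI) (metis InterD equiv_def transE)
  qed
  moreover have "(\<Squnion>\<^bsub>S\<^esub>(fst ` P), \<Squnion>\<^bsub>S\<^esub>(snd ` P)) \<in> \<Inter>?C" if "P \<subseteq> \<Inter>?C" for P
    using that by (auto simp: sup_congruence_def) blast
  ultimately show ?thesis
    by unfold_locales (simp add: sup_congruence_def generated_congruence_def)
qed

lemma generated_congruence_contains: "G \<subseteq> generated_congruence S G"
  by (auto simp: generated_congruence_def)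

text \<open>A kernel that contains the generators is one of the congruences being intersected, so it
  contains the generated congruence. No explicit description of the latter is then needed to lift a
  map.\<close>

lemma kernel_sup_congruence:
  assumes f: "sup_morphism S B f"
  shows "sup_congruence S {(x, y). x \<in> carrier S \<and> y \<in> carrier S \<and> f x = f y}"
    (is "sup_congruence S ?K")
  unfolding sup_congruence_def
proof (intro conjI allI impI)
  interpret complete_lattice S using f by (rule sup_morphism_lattices)
  show "equiv (carrier S) ?K" by (auto simp: equiv_def refl_on_def sym_def trans_def)
  fix P assume P: "P \<subseteq> ?K"
  then have sub: "fst ` P \<subseteq> carrier S" "snd ` P \<subseteq> carrier S" by auto
  have "f ` fst ` P = f ` snd ` P"
    unfolding image_image using P by (intro image_cong) auto
  then show "(\<Squnion>\<^bsub>S\<^esub>(fst ` P), \<Squnion>\<^bsub>S\<^esub>(snd ` P)) \<in> ?K"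
    using sub by (simp add: sup_morphism_sup[OF f])
qed

lemma generated_quotient_lift:
  assumes "G \<subseteq> carrier S \<times> carrier S" "sup_morphism S B f"
    and "\<And>x y. (x, y) \<in> G \<Longrightarrow> f x = f y"
  shows "\<exists>g. sup_morphism (sup_quotient S (generated_congruence S G)) B g \<and>
    (\<forall>x\<in>carrier S. g (generated_congruence S G `` {x}) = f x)"
proof -
  interpret sup_lattice_congruence S "generated_congruence S G"
    using assms sup_morphism_lattices generated_sup_congruence by blast
  have "generated_congruence S G \<subseteq> {(x, y). x \<in> carrier S \<and> y \<in> carrier S \<and> f x = f y}"
    unfolding generated_congruence_def
    using kernel_sup_congruence[OF assms(2)] assms(1,3) by (intro Inter_lower) auto
  then show ?thesis using assms(2) by (intro quotient_lift) auto
qed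

section \<open>Universal properties of the tensor products\<close>

lemma powerset_lattice_simps [simp]:
  "carrier (powerset_lattice X) = Pow X" "eq (powerset_lattice X) = (=)"
  "le (powerset_lattice X) = (\<subseteq>)"
  by (simp_all add: powerset_lattice_def)

lemma powerset_partial_order: "partial_order (powerset_lattice X)"
  by unfold_locales auto

lemma powerset_least:
  assumes "F \<subseteq> Pow X"
  shows "least (powerset_lattice X) (\<Union>F) (Upper (powerset_lattice X) F)"
proof (rule least_UpperI)
  fix V assume "V \<in> Upper (powerset_lattice X) F"
  then have "U \<subseteq> V" if "U \<in> F" for U
    using that assms Upper_memD[of V "powerset_lattice X" F U] by simp
  then show "\<Union>F \<sqsubseteq>\<^bsub>powerset_lattice X\<^esub> V" by (simp add: Union_least)
qed (use assms in auto)

lemma powerset_complete_lattice: "complete_lattice (powerset_lattice X)"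
proof (rule complete_latticeI_sup[OF powerset_partial_order])
  fix F assume "F \<subseteq> carrier (powerset_lattice X)"
  then have "F \<subseteq> Pow X" by simp
  then show "\<exists>s. least (powerset_lattice X) s (Upper (powerset_lattice X) F)"
    by (intro exI) (rule powerset_least)
qed

lemma powerset_sup:
  assumes "F \<subseteq> Pow X"
  shows "\<Squnion>\<^bsub>powerset_lattice X\<^esub>F = \<Union>F"
proof -
  interpret complete_lattice "powerset_lattice X" by (rule powerset_complete_lattice)
  from assms have "F \<subseteq> carrier (powerset_lattice X)" by simp
  then show ?thesis by (rule least_unique[OF sup_lub powerset_least[OF assms]])
qed

text \<open>The existence half of the freeness of the powerset: extending by joins works because the
  image of a union is the union of the images.\<close>

lemma powerset_lift:
  assumes "complete_lattice B" "f \<in> X \<rightarrow> carrier B"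
  shows "sup_morphism (powerset_lattice X) B (\<lambda>U. \<Squnion>\<^bsub>B\<^esub>(f ` U))"
proof (rule sup_morphismI)
  interpret B: complete_lattice B by fact
  show "\<Squnion>\<^bsub>B\<^esub>(f ` U) \<in> carrier B" if "U \<in> carrier (powerset_lattice X)" for U
    using that assms(2) by (intro B.sup_closed) auto
  fix F assume F: "F \<subseteq> carrier (powerset_lattice X)"
  then have "\<Squnion>\<^bsub>B\<^esub>(f ` (\<Squnion>\<^bsub>powerset_lattice X\<^esub>F)) = \<Squnion>\<^bsub>B\<^esub>(\<Union>U\<in>F. f ` U)"
    by (simp add: powerset_sup image_Union)
  also have "\<dots> = \<Squnion>\<^bsub>B\<^esub>((\<lambda>U. \<Squnion>\<^bsub>B\<^esub>(f ` U)) ` F)"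
    using F assms(2) by (intro B.sup_Union) auto
  finally show "\<Squnion>\<^bsub>B\<^esub>(f ` (\<Squnion>\<^bsub>powerset_lattice X\<^esub>F)) = \<Squnion>\<^bsub>B\<^esub>((\<lambda>U. \<Squnion>\<^bsub>B\<^esub>(f ` U)) ` F)" .
qed (use assms powerset_complete_lattice in auto)

section \<open>The tensor product of two sup-lattices\<close>

locale sup_lattice_pair = A: complete_lattice A + B: complete_lattice B
  for A :: "('a, 'm) gorder_scheme" and B :: "('b, 'n) gorder_scheme"
begin

abbreviation free :: "('a \<times> 'b) set gorder" where
  "free \<equiv> powerset_lattice (carrier A \<times> carrier B)"

text \<open>The generators that \<open>tensor_congruence\<close> contains inline, named so that they
  can be passed to the lemmas on generated congruences. Empty \<open>X\<close> and \<open>Y\<close>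
  are included, which sends tensors with a bottom element to bottom.\<close>

definition bilinearity_relations :: "(('a \<times> 'b) set \<times> ('a \<times> 'b) set) set" where
  "bilinearity_relations =
     {({(\<Squnion>\<^bsub>A\<^esub>X, b)}, X \<times> {b}) | X b. X \<subseteq> carrier A \<and> b \<in> carrier B} \<union>
     {({(a, \<Squnion>\<^bsub>B\<^esub>Y)}, {a} \<times> Y) | a Y. a \<in> carrier A \<and> Y \<subseteq> carrier B}"

lemma tensor_congruence_eq: "tensor_congruence A B = generated_congruence free bilinearity_relations"
  by (simp add: tensor_congruence_def bilinearity_relations_def)

lemma bilinearity_relations_closed: "bilinearity_relations \<subseteq> carrier free \<times> carrier free"
  by (auto simp: bilinearity_relations_def)

sublocale cong: sup_lattice_congruence free "tensor_congruence A B"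
  unfolding tensor_congruence_eq
  by (rule generated_sup_congruence[OF powerset_complete_lattice bilinearity_relations_closed])

lemma tensor_complete_lattice: "complete_lattice (sup_tensor A B)"
  unfolding sup_tensor_def by (rule cong.quotient_complete_lattice)

lemma tensor_projection:
  "sup_morphism free (sup_tensor A B) (\<lambda>U. tensor_congruence A B `` {U})"
  unfolding sup_tensor_def by (rule cong.projection_sup_morphism)

text \<open>\<open>U\<close> is the union of its singletons, and the projection preserves joins.
  This makes pure tensors generate, and it turns a defining relation into an equation between joins
  of pure tensors.\<close>

lemma tensor_class_eq_sup:
  assumes "U \<subseteq> carrier A \<times> carrier B"
  shows "tensor_congruence A B `` {U} = \<Squnion>\<^bsub>sup_tensor A B\<^esub>(case_prod (pure_tensor A B) ` U)"
proof -
  have sub: "(\<lambda>u. {u}) ` U \<subseteq> carrier free" using assms by auto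
  have "tensor_congruence A B `` {\<Squnion>\<^bsub>free\<^esub>((\<lambda>u. {u}) ` U)} =
      \<Squnion>\<^bsub>sup_tensor A B\<^esub>((\<lambda>V. tensor_congruence A B `` {V}) ` (\<lambda>u. {u}) ` U)"
    using tensor_projection sub by (rule sup_morphism_sup)
  moreover have "\<Squnion>\<^bsub>free\<^esub>((\<lambda>u. {u}) ` U) = U"
    using sub by (simp add: powerset_sup)
  moreover have "(\<lambda>V. tensor_congruence A B `` {V}) ` (\<lambda>u. {u}) ` U = case_prod (pure_tensor A B) ` U"
    unfolding image_image by (intro image_cong) (auto simp: pure_tensor_def)
  ultimately show ?thesis by simp
qed

lemma tensor_congruence_relations:
  "(U, V) \<in> bilinearity_relations \<Longrightarrow> tensor_congruence A B `` {U} = tensor_congruence A B `` {V}"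
  using generated_congruence_contains equiv_class_eq[OF cong.equivalence]
  unfolding tensor_congruence_eq by blast

lemma pure_tensor_closed:
  "\<lbrakk>a \<in> carrier A; b \<in> carrier B\<rbrakk> \<Longrightarrow> pure_tensor A B a b \<in> carrier (sup_tensor A B)"
  unfolding pure_tensor_def by (rule sup_morphism_closed[OF tensor_projection]) simp

lemma pure_tensor_bimorphism: "sup_bimorphism A B (sup_tensor A B) (pure_tensor A B)"
proof (intro sup_bimorphismI sup_morphismI)
  fix b X assume b: "b \<in> carrier B" and X: "X \<subseteq> carrier A"
  have "pure_tensor A B (\<Squnion>\<^bsub>A\<^esub>X) b = tensor_congruence A B `` {X \<times> {b}}"
    unfolding pure_tensor_def
    by (rule tensor_congruence_relations) (use b X in \<open>auto simp: bilinearity_relations_def\<close>)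
  also have "\<dots> = \<Squnion>\<^bsub>sup_tensor A B\<^esub>(case_prod (pure_tensor A B) ` (X \<times> {b}))"
    using b X by (intro tensor_class_eq_sup) auto
  also have "case_prod (pure_tensor A B) ` (X \<times> {b}) = (\<lambda>a. pure_tensor A B a b) ` X"
    by (auto simp: image_iff)
  finally show "pure_tensor A B (\<Squnion>\<^bsub>A\<^esub>X) b = \<Squnion>\<^bsub>sup_tensor A B\<^esub>((\<lambda>a. pure_tensor A B a b) ` X)" .
next
  fix a Y assume a: "a \<in> carrier A" and Y: "Y \<subseteq> carrier B"
  have "pure_tensor A B a (\<Squnion>\<^bsub>B\<^esub>Y) = tensor_congruence A B `` {{a} \<times> Y}"
    unfolding pure_tensor_def
    by (rule tensor_congruence_relations) (use a Y in \<open>auto simp: bilinearity_relations_def\<close>)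
  also have "\<dots> = \<Squnion>\<^bsub>sup_tensor A B\<^esub>(case_prod (pure_tensor A B) ` ({a} \<times> Y))"
    using a Y by (intro tensor_class_eq_sup) auto
  also have "case_prod (pure_tensor A B) ` ({a} \<times> Y) = pure_tensor A B a ` Y"
    by (auto simp: image_iff)
  finally show "pure_tensor A B a (\<Squnion>\<^bsub>B\<^esub>Y) = \<Squnion>\<^bsub>sup_tensor A B\<^esub>(pure_tensor A B a ` Y)" .
qed (auto intro: pure_tensor_closed tensor_complete_lattice A.complete_lattice_axioms
    B.complete_lattice_axioms)

lemma tensor_generated:
  assumes "x \<in> carrier (sup_tensor A B)"
  obtains U where "U \<subseteq> carrier A \<times> carrier B"
    "x = \<Squnion>\<^bsub>sup_tensor A B\<^esub>(case_prod (pure_tensor A B) ` U)"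
proof -
  obtain U where "U \<in> carrier free" "x = tensor_congruence A B `` {U}"
    using assms by (auto simp: sup_tensor_def elim: quotientE)
  then show thesis by (intro that[of U] tensor_class_eq_sup[THEN trans[rotated]]) auto
qed

lemma tensor_lift:
  assumes f: "sup_bimorphism A B C f"
  obtains g where "sup_morphism (sup_tensor A B) C g"
    "\<And>a b. \<lbrakk>a \<in> carrier A; b \<in> carrier B\<rbrakk> \<Longrightarrow> g (pure_tensor A B a b) = f a b"
proof -
  let ?h = "\<lambda>U. \<Squnion>\<^bsub>C\<^esub>(case_prod f ` U)"
  have fc: "f a b \<in> carrier C" if "a \<in> carrier A" "b \<in> carrier B" for a b
    using f that by (rule sup_bimorphism_closed)
  \<comment> \<open>\<open>sup_bimorphism\<close> speaks about the target lattice only through its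
    sections, so an element of \<open>B\<close> is needed to reach one; the bottom element is
    available.\<close>
  interpret C: complete_lattice C
    by (rule sup_morphism_lattices(2)[OF sup_bimorphism_left[OF f B.bottom_closed]])
  have h: "sup_morphism free C ?h"
    using fc by (intro powerset_lift) (auto simp: C.complete_lattice_axioms)
  \<comment> \<open>The two families of relations are respected precisely because \<open>f\<close>
    preserves joins in the first and in the second variable, respectively.\<close>
  have "?h U = ?h V" if "(U, V) \<in> bilinearity_relations" for U V
    using that unfolding bilinearity_relations_def
  proof (elim UnE CollectE exE conjE)
    fix X b assume "(U, V) = ({(\<Squnion>\<^bsub>A\<^esub>X, b)}, X \<times> {b})" and Xb: "X \<subseteq> carrier A" "b \<in> carrier B"
    moreover have "case_prod f ` (X \<times> {b}) = (\<lambda>a. f a b) ` X" by (auto simp: image_iff)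
    moreover have "f (\<Squnion>\<^bsub>A\<^esub>X) b \<in> carrier C" using Xb by (intro fc) auto
    ultimately show ?thesis
      using sup_morphism_sup[OF sup_bimorphism_left[OF f Xb(2)] Xb(1)] by simp
  next
    fix a Y assume "(U, V) = ({(a, \<Squnion>\<^bsub>B\<^esub>Y)}, {a} \<times> Y)" and aY: "a \<in> carrier A" "Y \<subseteq> carrier B"
    moreover have "case_prod f ` ({a} \<times> Y) = f a ` Y" by (auto simp: image_iff)
    moreover have "f a (\<Squnion>\<^bsub>B\<^esub>Y) \<in> carrier C" using aY by (intro fc) auto
    ultimately show ?thesis
      using sup_morphism_sup[OF sup_bimorphism_right[OF f aY(1)] aY(2)] by simp
  qed
  then obtain g where g: "sup_morphism (sup_tensor A B) C g"
    "\<And>U. U \<in> carrier free \<Longrightarrow> g (tensor_congruence A B `` {U}) = ?h U"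
    using generated_quotient_lift[OF bilinearity_relations_closed h]
    unfolding sup_tensor_def tensor_congruence_eq by blast
  have "g (pure_tensor A B a b) = f a b" if "a \<in> carrier A" "b \<in> carrier B" for a b
    using that fc g(2)[of "{(a, b)}"] by (simp add: pure_tensor_def)
  with g(1) show thesis by (rule that)
qed

end

text \<open>\<open>Q0\<close> and \<open>balanced_tensor\<close> are different records with the same
  carrier and order; lattice facts proved for one have to be carried to the other.\<close>

lemma complete_lattice_transfer:
  assumes "complete_lattice A" "carrier B = carrier A" "le B = le A" "eq B = (=)"
  shows "complete_lattice B"
proof (rule complete_latticeI_sup)
  interpret A: complete_lattice A by fact
  show "partial_order B"
    by unfold_locales (use assms in \<open>auto dest: A.le_antisym intro: A.le_trans\<close>)
  show "\<exists>s. least B s (Upper B X)" if "X \<subseteq> carrier B" for X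
    using A.sup_exists[of X] that assms by (simp add: least_def Upper_def)
qed

lemma Q0_simps [simp]:
  "carrier (Q0 \<T>) = carrier (balanced_tensor \<T>)" "le (Q0 \<T>) = le (balanced_tensor \<T>)"
  "eq (Q0 \<T>) = (=)" "qmult (Q0 \<T>) = Q0_mult \<T>"
  by (simp_all add: Q0_def)

lemma Q0_sup: "\<Squnion>\<^bsub>Q0 \<T>\<^esub>X = \<Squnion>\<^bsub>balanced_tensor \<T>\<^esub>X"
  by (simp add: sup_def least_def Upper_def)

section \<open>The balanced tensor product and its universal property\<close>

context triad
begin

abbreviation (input) \<L> where "\<L> \<equiv> TL \<T>"
abbreviation (input) \<R> where "\<R> \<equiv> TR \<T>"
abbreviation (input) \<S> where "\<S> \<equiv> TT \<T>"
abbreviation (input) left_action (infixr "\<rhd>" 75) where "t \<rhd> l \<equiv> actL \<T> t l"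
abbreviation (input) right_action (infixl "\<lhd>" 75) where "r \<lhd> t \<equiv> actR \<T> r t"
abbreviation (input) pair ("\<langle>_, _\<rangle>") where "\<langle>l, r\<rangle> \<equiv> pairing \<T> l r"
abbreviation (input) tensor (infix "\<otimes>" 70) where "r \<otimes> l \<equiv> pure \<T> r l"

sublocale RL: sup_lattice_pair \<R> \<L> ..

definition balancing_relations ::
    "(('r \<times> 'l) set set \<times> ('r \<times> 'l) set set) set" where
  "balancing_relations =
     {(pure_tensor \<R> \<L> (r \<lhd> t) l, pure_tensor \<R> \<L> r (t \<rhd> l)) | r t l.
        r \<in> carrier \<R> \<and> t \<in> carrier \<S> \<and> l \<in> carrier \<L>}"

lemma balanced_congruence_eq:
  "balanced_congruence \<T> = generated_congruence (sup_tensor \<R> \<L>) balancing_relations"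
  by (simp add: balanced_congruence_def balancing_relations_def)

lemma left_action_closed: "\<lbrakk>t \<in> carrier \<S>; l \<in> carrier \<L>\<rbrakk> \<Longrightarrow> t \<rhd> l \<in> carrier \<L>"
  by (rule sup_bimorphism_closed[OF L.left_action_bimorphism])

lemma right_action_closed: "\<lbrakk>r \<in> carrier \<R>; t \<in> carrier \<S>\<rbrakk> \<Longrightarrow> r \<lhd> t \<in> carrier \<R>"
  by (rule sup_bimorphism_closed[OF R.right_action_bimorphism])

lemma pair_closed: "\<lbrakk>l \<in> carrier \<L>; r \<in> carrier \<R>\<rbrakk> \<Longrightarrow> \<langle>l, r\<rangle> \<in> carrier \<S>"
  by (rule sup_bimorphism_closed[OF pairing_bimorphism])

lemmas action_closed = left_action_closed right_action_closed pair_closed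

lemma balancing_relations_closed:
  "balancing_relations \<subseteq> carrier (sup_tensor \<R> \<L>) \<times> carrier (sup_tensor \<R> \<L>)"
  by (auto simp: balancing_relations_def intro!: RL.pure_tensor_closed action_closed)

sublocale bal: sup_lattice_congruence "sup_tensor \<R> \<L>" "balanced_congruence \<T>"
  unfolding balanced_congruence_eq
  by (rule generated_sup_congruence[OF RL.tensor_complete_lattice balancing_relations_closed])

lemma Q0_complete_lattice: "complete_lattice (Q0 \<T>)"
  by (rule complete_lattice_transfer[OF bal.quotient_complete_lattice])
    (simp_all add: balanced_tensor_def)

sublocale Q0: complete_lattice "Q0 \<T>" by (rule Q0_complete_lattice)

text \<open>The choice defining the product refers to \<open>balanced_tensor\<close>, as
  \<open>Q0\<close> is built from that product, while the actions and \<open>\<phi>\<close> refer to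
  \<open>Q0\<close>. This equivalence moves between the two.\<close>

lemma balanced_sup_morphism_iff: 
  "sup_morphism (balanced_tensor \<T>) C f \<longleftrightarrow> sup_morphism (Q0 \<T>) C f"
  "sup_morphism C (balanced_tensor \<T>) g \<longleftrightarrow> sup_morphism C (Q0 \<T>) g"
  using Q0_complete_lattice bal.quotient_complete_lattice
  by (simp_all add: sup_morphism_def sup_pres_def Q0_sup balanced_tensor_def)

lemma balanced_projection:
  "sup_morphism (sup_tensor \<R> \<L>) (Q0 \<T>) (\<lambda>x. balanced_congruence \<T> `` {x})"
  using bal.projection_sup_morphism
  by (simp flip: balanced_sup_morphism_iff add: balanced_tensor_def)

lemma tensor_bimorphism: "sup_bimorphism \<R> \<L> (Q0 \<T>) (pure \<T>)"
  using sup_bimorphism_comp[OF balanced_projection RL.pure_tensor_bimorphism]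
  by (simp add: pure_def[abs_def])

lemma tensor_closed: "\<lbrakk>r \<in> carrier \<R>; l \<in> carrier \<L>\<rbrakk> \<Longrightarrow> r \<otimes> l \<in> carrier (Q0 \<T>)"
  by (rule sup_bimorphism_closed[OF tensor_bimorphism])

lemma tensor_balanced:
  assumes "r \<in> carrier \<R>" "t \<in> carrier \<S>" "l \<in> carrier \<L>"
  shows "(r \<lhd> t) \<otimes> l = r \<otimes> (t \<rhd> l)"
proof -
  have "(pure_tensor \<R> \<L> (r \<lhd> t) l, pure_tensor \<R> \<L> r (t \<rhd> l)) \<in> balancing_relations"
    using assms by (auto simp: balancing_relations_def)
  then have "(pure_tensor \<R> \<L> (r \<lhd> t) l, pure_tensor \<R> \<L> r (t \<rhd> l)) \<in> balanced_congruence \<T>"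
    using generated_congruence_contains unfolding balanced_congruence_eq by blast
  then show ?thesis
    unfolding pure_def by (rule equiv_class_eq[OF bal.equivalence])
qed

text \<open>Generation by pure tensors passes along the projection from the unbalanced tensor
  product, since that map is surjective and preserves joins.\<close>

lemma Q0_generated:
  assumes "c \<in> carrier (Q0 \<T>)"
  obtains U where "U \<subseteq> carrier \<R> \<times> carrier \<L>" "c = \<Squnion>\<^bsub>Q0 \<T>\<^esub>(case_prod (pure \<T>) ` U)"
proof -
  obtain x where x: "x \<in> carrier (sup_tensor \<R> \<L>)" "c = balanced_congruence \<T> `` {x}"
    using assms by (auto simp: balanced_tensor_def elim: quotientE)
  obtain U where U: "U \<subseteq> carrier \<R> \<times> carrier \<L>"
    "x = \<Squnion>\<^bsub>sup_tensor \<R> \<L>\<^esub>(case_prod (pure_tensor \<R> \<L>) ` U)"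
    using x(1) by (rule RL.tensor_generated)
  have "case_prod (pure_tensor \<R> \<L>) ` U \<subseteq> carrier (sup_tensor \<R> \<L>)"
    using U(1) by (auto intro: RL.pure_tensor_closed)
  then have "c = \<Squnion>\<^bsub>Q0 \<T>\<^esub>((\<lambda>x. balanced_congruence \<T> `` {x}) ` case_prod (pure_tensor \<R> \<L>) ` U)"
    unfolding x(2) U(2) by (rule sup_morphism_sup[OF balanced_projection])
  also have "(\<lambda>x. balanced_congruence \<T> `` {x}) ` case_prod (pure_tensor \<R> \<L>) ` U = case_prod (pure \<T>) ` U"
    unfolding image_image by (intro image_cong) (auto simp: pure_def)
  finally show thesis by (rule that[OF U(1)])
qed

lemma Q0_eqI:
  assumes f: "sup_morphism (Q0 \<T>) C f" and g: "sup_morphism (Q0 \<T>) C g"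
    and eq: "\<And>r l. \<lbrakk>r \<in> carrier \<R>; l \<in> carrier \<L>\<rbrakk> \<Longrightarrow> f (r \<otimes> l) = g (r \<otimes> l)"
    and c: "c \<in> carrier (Q0 \<T>)"
  shows "f c = g c"
proof -
  obtain U where U: "U \<subseteq> carrier \<R> \<times> carrier \<L>" "c = \<Squnion>\<^bsub>Q0 \<T>\<^esub>(case_prod (pure \<T>) ` U)"
    using c by (rule Q0_generated)
  have sub: "case_prod (pure \<T>) ` U \<subseteq> carrier (Q0 \<T>)"
    using U(1) tensor_closed by auto
  have "f ` case_prod (pure \<T>) ` U = g ` case_prod (pure \<T>) ` U"
    unfolding image_image using U(1) eq by (intro image_cong) auto
  then show ?thesis
    unfolding U(2) sup_morphism_sup[OF f sub] sup_morphism_sup[OF g sub] by simp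
qed

text \<open>The lift is made twice, through the tensor product and then through the balancing
  quotient; \<open>bal\<close> says that the first lift respects the generators of the second
  congruence.\<close>

lemma Q0_lift:
  assumes f: "sup_bimorphism \<R> \<L> C f"
    and bal: "\<And>r t l. \<lbrakk>r \<in> carrier \<R>; t \<in> carrier \<S>; l \<in> carrier \<L>\<rbrakk> \<Longrightarrow> f (r \<lhd> t) l = f r (t \<rhd> l)"
  obtains g where "sup_morphism (Q0 \<T>) C g"
    "\<And>r l. \<lbrakk>r \<in> carrier \<R>; l \<in> carrier \<L>\<rbrakk> \<Longrightarrow> g (r \<otimes> l) = f r l"
proof -
  obtain h where h: "sup_morphism (sup_tensor \<R> \<L>) C h"
    "\<And>r l. \<lbrakk>r \<in> carrier \<R>; l \<in> carrier \<L>\<rbrakk> \<Longrightarrow> h (pure_tensor \<R> \<L> r l) = f r l"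
    using RL.tensor_lift[OF f] by blast
  have "h x = h y" if "(x, y) \<in> balancing_relations" for x y
    using that by (auto simp: balancing_relations_def h(2) action_closed bal)
  then obtain g where g: "sup_morphism (balanced_tensor \<T>) C g"
    "\<And>x. x \<in> carrier (sup_tensor \<R> \<L>) \<Longrightarrow> g (balanced_congruence \<T> `` {x}) = h x"
    using generated_quotient_lift[OF balancing_relations_closed h(1)]
    unfolding balanced_tensor_def balanced_congruence_eq by blast
  show thesis
  proof (rule that)
    show "sup_morphism (Q0 \<T>) C g" using g(1) by (simp add: balanced_sup_morphism_iff)
    show "g (r \<otimes> l) = f r l" if "r \<in> carrier \<R>" "l \<in> carrier \<L>" for r l
      using that g(2) h(2) RL.pure_tensor_closed by (simp add: pure_def)
  qed
qed

text \<open>Maps obtained from \<open>Q0_lift\<close> are constructed separately for each parameter,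
  so dependence on the parameter is uncontrolled. For a set \<open>X\<close> of parameters, the map
  at \<open>\<Squnion>X\<close> and the pointwise join of the maps at the members of
  \<open>X\<close> both preserve joins in \<open>c\<close>, so it suffices to compare them on
  tensors.\<close>

lemma Q0_sup_morphism_parameter:
  assumes A: "complete_lattice A"
    and f: "\<And>a. a \<in> carrier A \<Longrightarrow> sup_morphism (Q0 \<T>) B (f a)"
    and pure: "\<And>r l. \<lbrakk>r \<in> carrier \<R>; l \<in> carrier \<L>\<rbrakk> \<Longrightarrow> sup_morphism A B (\<lambda>a. f a (r \<otimes> l))"
    and c: "c \<in> carrier (Q0 \<T>)"
  shows "sup_morphism A B (\<lambda>a. f a c)"
proof -
  interpret A: complete_lattice A by fact
  have B: "complete_lattice B" by (rule sup_morphism_lattices(2)[OF f[OF A.bottom_closed]])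
  show ?thesis
  proof (rule sup_morphismI[OF A B])
    show "f a c \<in> carrier B" if "a \<in> carrier A" for a
      using f[OF that] c by (rule sup_morphism_closed)
    fix X assume X: "X \<subseteq> carrier A"
    show "f (\<Squnion>\<^bsub>A\<^esub>X) c = \<Squnion>\<^bsub>B\<^esub>((\<lambda>a. f a c) ` X)"
    proof (rule Q0_eqI[where f = "f (\<Squnion>\<^bsub>A\<^esub>X)" and g = "\<lambda>c. \<Squnion>\<^bsub>B\<^esub>((\<lambda>a. f a c) ` X)", OF _ _ _ c])
      show "sup_morphism (Q0 \<T>) B (f (\<Squnion>\<^bsub>A\<^esub>X))" using X f by simp
      show "sup_morphism (Q0 \<T>) B (\<lambda>c. \<Squnion>\<^bsub>B\<^esub>((\<lambda>a. f a c) ` X))"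
        using X f by (intro sup_morphism_Sup[OF Q0_complete_lattice B]) auto
      show "f (\<Squnion>\<^bsub>A\<^esub>X) (r \<otimes> l) = \<Squnion>\<^bsub>B\<^esub>((\<lambda>a. f a (r \<otimes> l)) ` X)"
        if "r \<in> carrier \<R>" "l \<in> carrier \<L>" for r l
        using sup_morphism_sup[OF pure[OF that] X] .
    qed
  qed
qed

end

section \<open>The quantale of compatible pairs\<close>

context triad
begin

lemma Q1_qmult: "p \<cdot>\<^bsub>Q1 \<T>\<^esub> q = (compose (carrier \<L>) (fst q) (fst p), compose (carrier \<R>) (snd p) (snd q))"
  by (simp add: Q1_def split_beta)

lemma Q1_le:
  "p \<sqsubseteq>\<^bsub>Q1 \<T>\<^esub> q \<longleftrightarrow> (\<forall>l\<in>carrier \<L>. fst p l \<sqsubseteq>\<^bsub>\<L>\<^esub> fst q l) \<and> (\<forall>r\<in>carrier \<R>. snd p r \<sqsubseteq>\<^bsub>\<R>\<^esub> snd q r)"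
  by (simp add: Q1_def split_beta)

lemma Q1I:
  assumes "\<alpha> \<in> extensional (carrier \<L>)" "\<beta> \<in> extensional (carrier \<R>)"
    and "sup_morphism \<L> \<L> \<alpha>" "sup_morphism \<R> \<R> \<beta>"
    and "\<And>t l. \<lbrakk>t \<in> carrier \<S>; l \<in> carrier \<L>\<rbrakk> \<Longrightarrow> \<alpha> (t \<rhd> l) = t \<rhd> \<alpha> l"
    and "\<And>r t. \<lbrakk>r \<in> carrier \<R>; t \<in> carrier \<S>\<rbrakk> \<Longrightarrow> \<beta> (r \<lhd> t) = \<beta> r \<lhd> t"
    and "\<And>l r. \<lbrakk>l \<in> carrier \<L>; r \<in> carrier \<R>\<rbrakk> \<Longrightarrow> \<langle>\<alpha> l, r\<rangle> = \<langle>l, \<beta> r\<rangle>"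
  shows "(\<alpha>, \<beta>) \<in> carrier (Q1 \<T>)"
  using assms by (simp add: Q1_def left_module_morphism_def right_module_morphism_def)

context
  fixes q assumes q: "q \<in> carrier (Q1 \<T>)"
begin

lemma Q1_extensional: "fst q \<in> extensional (carrier \<L>)" "snd q \<in> extensional (carrier \<R>)"
  using q by (auto simp: Q1_def)

lemma Q1_sup_morphism: "sup_morphism \<L> \<L> (fst q)" "sup_morphism \<R> \<R> (snd q)"
  using q by (auto simp: Q1_def left_module_morphism_def right_module_morphism_def)

lemma Q1_fst_closed: "l \<in> carrier \<L> \<Longrightarrow> fst q l \<in> carrier \<L>"
  by (rule sup_morphism_closed[OF Q1_sup_morphism(1)])

lemma Q1_snd_closed: "r \<in> carrier \<R> \<Longrightarrow> snd q r \<in> carrier \<R>"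
  by (rule sup_morphism_closed[OF Q1_sup_morphism(2)])

lemma Q1_fst_action: "\<lbrakk>t \<in> carrier \<S>; l \<in> carrier \<L>\<rbrakk> \<Longrightarrow> fst q (t \<rhd> l) = t \<rhd> fst q l"
  using q by (auto simp: Q1_def left_module_morphism_def)

lemma Q1_snd_action: "\<lbrakk>r \<in> carrier \<R>; t \<in> carrier \<S>\<rbrakk> \<Longrightarrow> snd q (r \<lhd> t) = snd q r \<lhd> t"
  using q by (auto simp: Q1_def right_module_morphism_def)

lemma Q1_adjoint: "\<lbrakk>l \<in> carrier \<L>; r \<in> carrier \<R>\<rbrakk> \<Longrightarrow> \<langle>fst q l, r\<rangle> = \<langle>l, snd q r\<rangle>"
  using q by (auto simp: Q1_def)

end

lemmas Q1_closed = Q1_fst_closed Q1_snd_closed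

text \<open>Extensionality turns agreement on the carriers into equality; without it the pointwise
  order would not be antisymmetric.\<close>

lemma Q1_eqI:
  assumes p: "p \<in> carrier (Q1 \<T>)" and q: "q \<in> carrier (Q1 \<T>)"
    and l: "\<And>l. l \<in> carrier \<L> \<Longrightarrow> fst p l = fst q l"
    and r: "\<And>r. r \<in> carrier \<R> \<Longrightarrow> snd p r = snd q r"
  shows "p = q"
proof (rule prod_eqI)
  show "fst p = fst q" by (rule extensionalityI[OF Q1_extensional(1)[OF p] Q1_extensional(1)[OF q] l])
  show "snd p = snd q" by (rule extensionalityI[OF Q1_extensional(2)[OF p] Q1_extensional(2)[OF q] r])
qed

lemma Q1_partial_order: "partial_order (Q1 \<T>)"
proof
  have eq: "eq (Q1 \<T>) = (=)" by (simp add: Q1_def)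
  then show "eq (Q1 \<T>) = (=)" .
  fix p assume p: "p \<in> carrier (Q1 \<T>)"
  then show "p .=\<^bsub>Q1 \<T>\<^esub> p" "p \<sqsubseteq>\<^bsub>Q1 \<T>\<^esub> p" by (simp_all add: eq Q1_le Q1_closed)
  fix q assume q: "q \<in> carrier (Q1 \<T>)"
  { assume "p .=\<^bsub>Q1 \<T>\<^esub> q" then show "q .=\<^bsub>Q1 \<T>\<^esub> p" by (simp add: eq) }
  { assume "p \<sqsubseteq>\<^bsub>Q1 \<T>\<^esub> q" "q \<sqsubseteq>\<^bsub>Q1 \<T>\<^esub> p"
    with p q have "p = q"
      by (intro Q1_eqI L.M.le_antisym R.M.le_antisym) (simp_all add: Q1_le Q1_closed)
    then show "p .=\<^bsub>Q1 \<T>\<^esub> q" by (simp add: eq) }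
  fix r assume r: "r \<in> carrier (Q1 \<T>)"
  { assume "p .=\<^bsub>Q1 \<T>\<^esub> q" "q .=\<^bsub>Q1 \<T>\<^esub> r" then show "p .=\<^bsub>Q1 \<T>\<^esub> r" by (simp add: eq) }
  { assume "p \<sqsubseteq>\<^bsub>Q1 \<T>\<^esub> q" "q \<sqsubseteq>\<^bsub>Q1 \<T>\<^esub> r"
    with p q r show "p \<sqsubseteq>\<^bsub>Q1 \<T>\<^esub> r"
      unfolding Q1_le by (blast intro: L.M.le_trans R.M.le_trans Q1_closed) }
  { fix s assume "p .=\<^bsub>Q1 \<T>\<^esub> q" "r .=\<^bsub>Q1 \<T>\<^esub> s"
    then show "p \<sqsubseteq>\<^bsub>Q1 \<T>\<^esub> r \<longleftrightarrow> q \<sqsubseteq>\<^bsub>Q1 \<T>\<^esub> s" by (simp add: eq) }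
qed

section \<open>Joins in the quantale of compatible pairs\<close>

definition pointwise_sup :: "(('l \<Rightarrow> 'l) \<times> ('r \<Rightarrow> 'r)) set \<Rightarrow> ('l \<Rightarrow> 'l) \<times> ('r \<Rightarrow> 'r)" where
  "pointwise_sup F =
     (\<lambda>l\<in>carrier \<L>. \<Squnion>\<^bsub>\<L>\<^esub>((\<lambda>q. fst q l) ` F), \<lambda>r\<in>carrier \<R>. \<Squnion>\<^bsub>\<R>\<^esub>((\<lambda>q. snd q r) ` F))"

context
  fixes F assumes F: "F \<subseteq> carrier (Q1 \<T>)"
begin

lemma fst_image_closed: "l \<in> carrier \<L> \<Longrightarrow> (\<lambda>q. fst q l) ` F \<subseteq> carrier \<L>"
  using F Q1_fst_closed by blast

lemma snd_image_closed: "r \<in> carrier \<R> \<Longrightarrow> (\<lambda>q. snd q r) ` F \<subseteq> carrier \<R>"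
  using F Q1_snd_closed by blast

text \<open>The conditions on a compatible pair survive pointwise joins because the actions preserve
  joins in the module variable and the pairing preserves them in both variables.\<close>

lemma pointwise_sup_closed: "pointwise_sup F \<in> carrier (Q1 \<T>)"
  unfolding pointwise_sup_def
proof (rule Q1I)
  let ?\<alpha> = "\<lambda>l. \<Squnion>\<^bsub>\<L>\<^esub>((\<lambda>q. fst q l) ` F)" and ?\<beta> = "\<lambda>r. \<Squnion>\<^bsub>\<R>\<^esub>((\<lambda>q. snd q r) ` F)"
  have "sup_morphism \<L> \<L> ?\<alpha>"
    using F Q1_sup_morphism(1)
    by (intro sup_morphism_Sup L.M.complete_lattice_axioms) auto
  then show "sup_morphism \<L> \<L> (restrict ?\<alpha> (carrier \<L>))"
    by (rule sup_morphism_cong) simp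
  have "sup_morphism \<R> \<R> ?\<beta>"
    using F Q1_sup_morphism(2)
    by (intro sup_morphism_Sup R.M.complete_lattice_axioms) auto
  then show "sup_morphism \<R> \<R> (restrict ?\<beta> (carrier \<R>))"
    by (rule sup_morphism_cong) simp
  fix t l assume t: "t \<in> carrier \<S>" and l: "l \<in> carrier \<L>"
  have "t \<rhd> ?\<alpha> l = \<Squnion>\<^bsub>\<L>\<^esub>((\<lambda>l. t \<rhd> l) ` (\<lambda>q. fst q l) ` F)"
    by (rule sup_morphism_sup[OF sup_bimorphism_right[OF L.left_action_bimorphism t] fst_image_closed[OF l]])
  also have "(\<lambda>l. t \<rhd> l) ` (\<lambda>q. fst q l) ` F = (\<lambda>q. fst q (t \<rhd> l)) ` F"
    unfolding image_image using t l by (intro image_cong) (simp_all add: Q1_fst_action[OF subsetD[OF F]])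
  finally show "restrict ?\<alpha> (carrier \<L>) (t \<rhd> l) = t \<rhd> restrict ?\<alpha> (carrier \<L>) l"
    using t l by (simp add: left_action_closed)
next
  let ?\<beta> = "\<lambda>r. \<Squnion>\<^bsub>\<R>\<^esub>((\<lambda>q. snd q r) ` F)"
  fix r t assume t: "t \<in> carrier \<S>" and r: "r \<in> carrier \<R>"
  have "?\<beta> r \<lhd> t = \<Squnion>\<^bsub>\<R>\<^esub>((\<lambda>r. r \<lhd> t) ` (\<lambda>q. snd q r) ` F)"
    by (rule sup_morphism_sup[OF sup_bimorphism_left[OF R.right_action_bimorphism t] snd_image_closed[OF r]])
  also have "(\<lambda>r. r \<lhd> t) ` (\<lambda>q. snd q r) ` F = (\<lambda>q. snd q (r \<lhd> t)) ` F"
    unfolding image_image using t r by (intro image_cong) (simp_all add: Q1_snd_action[OF subsetD[OF F]])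
  finally show "restrict ?\<beta> (carrier \<R>) (r \<lhd> t) = restrict ?\<beta> (carrier \<R>) r \<lhd> t"
    using t r by (simp add: right_action_closed)
next
  let ?\<alpha> = "\<lambda>l. \<Squnion>\<^bsub>\<L>\<^esub>((\<lambda>q. fst q l) ` F)" and ?\<beta> = "\<lambda>r. \<Squnion>\<^bsub>\<R>\<^esub>((\<lambda>q. snd q r) ` F)"
  fix l r assume l: "l \<in> carrier \<L>" and r: "r \<in> carrier \<R>"
  have "\<langle>?\<alpha> l, r\<rangle> = \<Squnion>\<^bsub>\<S>\<^esub>((\<lambda>l. \<langle>l, r\<rangle>) ` (\<lambda>q. fst q l) ` F)"
    by (rule sup_morphism_sup[OF sup_bimorphism_left[OF pairing_bimorphism r] fst_image_closed[OF l]])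
  also have "(\<lambda>l. \<langle>l, r\<rangle>) ` (\<lambda>q. fst q l) ` F = (\<lambda>r. \<langle>l, r\<rangle>) ` (\<lambda>q. snd q r) ` F"
    unfolding image_image using l r by (intro image_cong) (simp_all add: Q1_adjoint[OF subsetD[OF F]])
  also have "\<Squnion>\<^bsub>\<S>\<^esub>\<dots> = \<langle>l, ?\<beta> r\<rangle>"
    by (rule sup_morphism_sup[OF sup_bimorphism_right[OF pairing_bimorphism l] snd_image_closed[OF r], symmetric])
  finally show "\<langle>restrict ?\<alpha> (carrier \<L>) l, r\<rangle> = \<langle>l, restrict ?\<beta> (carrier \<R>) r\<rangle>"
    using l r by simp
qed simp_all

lemma pointwise_sup_least: "least (Q1 \<T>) (pointwise_sup F) (Upper (Q1 \<T>) F)"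
proof (rule least_UpperI)
  show "q \<sqsubseteq>\<^bsub>Q1 \<T>\<^esub> pointwise_sup F" if "q \<in> F" for q
    using that
    by (simp add: Q1_le pointwise_sup_def L.M.sup_upper[OF fst_image_closed]
        R.M.sup_upper[OF snd_image_closed])
  fix p assume p: "p \<in> Upper (Q1 \<T>) F"
  then have pc: "p \<in> carrier (Q1 \<T>)" by (simp add: Upper_def)
  have le: "q \<sqsubseteq>\<^bsub>Q1 \<T>\<^esub> p" if "q \<in> F" for q using Upper_memD[OF p that F] by simp
  have "\<Squnion>\<^bsub>\<L>\<^esub>((\<lambda>q. fst q l) ` F) \<sqsubseteq>\<^bsub>\<L>\<^esub> fst p l" if "l \<in> carrier \<L>" for l
    using le that by (intro L.M.sup_least fst_image_closed Q1_fst_closed pc) (auto simp: Q1_le)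
  moreover have "\<Squnion>\<^bsub>\<R>\<^esub>((\<lambda>q. snd q r) ` F) \<sqsubseteq>\<^bsub>\<R>\<^esub> snd p r" if "r \<in> carrier \<R>" for r
    using le that by (intro R.M.sup_least snd_image_closed Q1_snd_closed pc) (auto simp: Q1_le)
  ultimately show "pointwise_sup F \<sqsubseteq>\<^bsub>Q1 \<T>\<^esub> p"
    by (simp add: Q1_le pointwise_sup_def)
qed (fact F pointwise_sup_closed)+

end

lemma Q1_complete_lattice: "complete_lattice (Q1 \<T>)"
proof (rule complete_latticeI_sup[OF Q1_partial_order])
  show "\<exists>s. least (Q1 \<T>) s (Upper (Q1 \<T>) F)" if "F \<subseteq> carrier (Q1 \<T>)" for F
    using pointwise_sup_least[OF that] by blast
qed

sublocale Q1: complete_lattice "Q1 \<T>" by (rule Q1_complete_lattice)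

lemma Q1_sup: 
  assumes "F \<subseteq> carrier (Q1 \<T>)"
  shows "\<Squnion>\<^bsub>Q1 \<T>\<^esub>F = pointwise_sup F"
  by (rule Q1.least_unique[OF Q1.sup_lub[OF assms] pointwise_sup_least[OF assms]])

lemma Q1_fst_sup_morphism:
  assumes "l \<in> carrier \<L>"
  shows "sup_morphism (Q1 \<T>) \<L> (\<lambda>q. fst q l)"
  by (rule sup_morphismI)
    (use assms in \<open>simp_all add: Q1_sup pointwise_sup_def Q1_fst_closed
      Q1_complete_lattice L.M.complete_lattice_axioms\<close>)

lemma Q1_snd_sup_morphism:
  assumes "r \<in> carrier \<R>"
  shows "sup_morphism (Q1 \<T>) \<R> (\<lambda>q. snd q r)"
  by (rule sup_morphismI)
    (use assms in \<open>simp_all add: Q1_sup pointwise_sup_def Q1_snd_closed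
      Q1_complete_lattice R.M.complete_lattice_axioms\<close>)

text \<open>Since joins of \<open>Q1\<close> are pointwise, the evaluations at elements of
  \<open>L\<close> and \<open>R\<close> jointly detect them. Maps into \<open>Q1\<close> are
  therefore checked one evaluation at a time.\<close>

lemma Q1_sup_morphismI:
  assumes A: "complete_lattice A"
    and f: "\<And>a. a \<in> carrier A \<Longrightarrow> f a \<in> carrier (Q1 \<T>)"
    and fst: "\<And>l. l \<in> carrier \<L> \<Longrightarrow> sup_morphism A \<L> (\<lambda>a. fst (f a) l)"
    and snd: "\<And>r. r \<in> carrier \<R> \<Longrightarrow> sup_morphism A \<R> (\<lambda>a. snd (f a) r)"
  shows "sup_morphism A (Q1 \<T>) f"
proof (rule sup_morphismI[OF A Q1_complete_lattice f])
  interpret A: complete_lattice A by fact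
  fix X assume X: "X \<subseteq> carrier A"
  then have fX: "f ` X \<subseteq> carrier (Q1 \<T>)" using f by auto
  show "f (\<Squnion>\<^bsub>A\<^esub>X) = \<Squnion>\<^bsub>Q1 \<T>\<^esub>(f ` X)"
    unfolding Q1_sup[OF fX]
  proof (rule Q1_eqI)
    show "f (\<Squnion>\<^bsub>A\<^esub>X) \<in> carrier (Q1 \<T>)" using X by (intro f) simp
    show "pointwise_sup (f ` X) \<in> carrier (Q1 \<T>)" using fX by (rule pointwise_sup_closed)
    show "fst (f (\<Squnion>\<^bsub>A\<^esub>X)) l = fst (pointwise_sup (f ` X)) l" if "l \<in> carrier \<L>" for l
      using sup_morphism_sup[OF fst[OF that] X] that by (simp add: pointwise_sup_def image_image)
    show "snd (f (\<Squnion>\<^bsub>A\<^esub>X)) r = snd (pointwise_sup (f ` X)) r" if "r \<in> carrier \<R>" for r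
      using sup_morphism_sup[OF snd[OF that] X] that by (simp add: pointwise_sup_def image_image)
  qed
qed

text \<open>The first components compose in the opposite order, since \<open>L\<close> is to be a
  right module and \<open>R\<close> a left module over \<open>Q1\<close>.\<close>

lemma Q1_qmult_apply:
  "l \<in> carrier \<L> \<Longrightarrow> fst (p \<cdot>\<^bsub>Q1 \<T>\<^esub> q) l = fst q (fst p l)"
  "r \<in> carrier \<R> \<Longrightarrow> snd (p \<cdot>\<^bsub>Q1 \<T>\<^esub> q) r = snd p (snd q r)"
  by (simp_all add: Q1_qmult compose_def)

lemma Q1_qmult_closed:
  assumes p: "p \<in> carrier (Q1 \<T>)" and q: "q \<in> carrier (Q1 \<T>)"
  shows "p \<cdot>\<^bsub>Q1 \<T>\<^esub> q \<in> carrier (Q1 \<T>)"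
proof -
  have "sup_morphism \<L> \<L> (\<lambda>l. fst q (fst p l))"
    by (rule sup_morphism_comp[OF Q1_sup_morphism(1)[OF q] Q1_sup_morphism(1)[OF p]])
  then have 1: "sup_morphism \<L> \<L> (compose (carrier \<L>) (fst q) (fst p))"
    by (rule sup_morphism_cong) (simp add: compose_def)
  have "sup_morphism \<R> \<R> (\<lambda>l. snd p (snd q l))"
    by (rule sup_morphism_comp[OF Q1_sup_morphism(2)[OF p] Q1_sup_morphism(2)[OF q]])
  then have 2: "sup_morphism \<R> \<R> (compose (carrier \<R>) (snd p) (snd q))"
    by (rule sup_morphism_cong) (simp add: compose_def)
  show ?thesis
    unfolding Q1_qmult
    by (rule Q1I) (simp_all add: 1 2 compose_extensional, simp_all add: compose_def action_closed
        Q1_closed[OF p] Q1_closed[OF q] Q1_fst_action[OF p] Q1_fst_action[OF q]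
        Q1_snd_action[OF p] Q1_snd_action[OF q] Q1_adjoint[OF p] Q1_adjoint[OF q])
qed

lemma Q1_quantale: "quantale (Q1 \<T>)"
proof
  show "sup_bimorphism (Q1 \<T>) (Q1 \<T>) (Q1 \<T>) (qmult (Q1 \<T>))"
  proof (rule sup_bimorphismI)
    fix q assume q: "q \<in> carrier (Q1 \<T>)"
    show "sup_morphism (Q1 \<T>) (Q1 \<T>) (\<lambda>p. p \<cdot>\<^bsub>Q1 \<T>\<^esub> q)"
    proof (rule Q1_sup_morphismI[OF Q1_complete_lattice])
      show "sup_morphism (Q1 \<T>) \<L> (\<lambda>p. fst (p \<cdot>\<^bsub>Q1 \<T>\<^esub> q) l)" if l: "l \<in> carrier \<L>" for l
        unfolding Q1_qmult_apply(1)[OF l]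
        by (rule sup_morphism_comp[OF Q1_sup_morphism(1)[OF q] Q1_fst_sup_morphism[OF l]])
      show "sup_morphism (Q1 \<T>) \<R> (\<lambda>p. snd (p \<cdot>\<^bsub>Q1 \<T>\<^esub> q) r)" if r: "r \<in> carrier \<R>" for r
        unfolding Q1_qmult_apply(2)[OF r]
        by (rule Q1_snd_sup_morphism[OF Q1_snd_closed[OF q r]])
    qed (rule Q1_qmult_closed[OF _ q])
    show "sup_morphism (Q1 \<T>) (Q1 \<T>) (\<lambda>p. q \<cdot>\<^bsub>Q1 \<T>\<^esub> p)"
    proof (rule Q1_sup_morphismI[OF Q1_complete_lattice])
      show "sup_morphism (Q1 \<T>) \<L> (\<lambda>p. fst (q \<cdot>\<^bsub>Q1 \<T>\<^esub> p) l)" if l: "l \<in> carrier \<L>" for l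
        unfolding Q1_qmult_apply(1)[OF l]
        by (rule Q1_fst_sup_morphism[OF Q1_fst_closed[OF q l]])
      show "sup_morphism (Q1 \<T>) \<R> (\<lambda>p. snd (q \<cdot>\<^bsub>Q1 \<T>\<^esub> p) r)" if r: "r \<in> carrier \<R>" for r
        unfolding Q1_qmult_apply(2)[OF r]
        by (rule sup_morphism_comp[OF Q1_sup_morphism(2)[OF q] Q1_snd_sup_morphism[OF r]])
    qed (rule Q1_qmult_closed[OF q])
  qed
  fix p q s assume "p \<in> carrier (Q1 \<T>)" "q \<in> carrier (Q1 \<T>)" "s \<in> carrier (Q1 \<T>)"
  then show "(p \<cdot>\<^bsub>Q1 \<T>\<^esub> q) \<cdot>\<^bsub>Q1 \<T>\<^esub> s = p \<cdot>\<^bsub>Q1 \<T>\<^esub> (q \<cdot>\<^bsub>Q1 \<T>\<^esub> s)"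
    by (intro Q1_eqI Q1_qmult_closed) (simp_all add: Q1_qmult_apply Q1_closed)
qed

definition Q1_one :: "('l \<Rightarrow> 'l) \<times> ('r \<Rightarrow> 'r)" where
  "Q1_one = (\<lambda>l\<in>carrier \<L>. l, \<lambda>r\<in>carrier \<R>. r)"

lemma Q1_one_closed: "Q1_one \<in> carrier (Q1 \<T>)"
  unfolding Q1_one_def
proof (rule Q1I)
  show "sup_morphism \<L> \<L> (\<lambda>l\<in>carrier \<L>. l)"
    by (rule sup_morphism_cong[OF sup_morphism_id[OF L.M.complete_lattice_axioms]]) simp
  show "sup_morphism \<R> \<R> (\<lambda>r\<in>carrier \<R>. r)"
    by (rule sup_morphism_cong[OF sup_morphism_id[OF R.M.complete_lattice_axioms]]) simp
qed (simp_all add: action_closed)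

lemma Q1_one_unit: "is_unit (Q1 \<T>) Q1_one"
  unfolding is_unit_def
proof (intro conjI ballI Q1_one_closed)
  fix q assume q: "q \<in> carrier (Q1 \<T>)"
  show "Q1_one \<cdot>\<^bsub>Q1 \<T>\<^esub> q = q" "q \<cdot>\<^bsub>Q1 \<T>\<^esub> Q1_one = q"
    using q by (auto intro!: Q1_eqI Q1_qmult_closed Q1_one_closed
        simp: Q1_qmult_apply Q1_closed, simp_all add: Q1_one_def Q1_closed)
qed

section \<open>The actions on the balanced tensors\<close>

text \<open>For a fixed pair the map is balanced because its second component is right
  \<open>T\<close>-linear. One lift is then chosen for each pair, and preservation of joins in the
  pair is recovered by \<open>Q0_sup_morphism_parameter\<close>.\<close>

lemma Q0_left_act_exists:
  "\<exists>a. sup_bimorphism (Q1 \<T>) (Q0 \<T>) (Q0 \<T>) a \<and>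
     (\<forall>q\<in>carrier (Q1 \<T>). \<forall>r\<in>carrier \<R>. \<forall>l\<in>carrier \<L>. a q (r \<otimes> l) = Q1_act_R q r \<otimes> l)"
proof -
  have "\<exists>g. sup_morphism (Q0 \<T>) (Q0 \<T>) g \<and>
      (\<forall>r\<in>carrier \<R>. \<forall>l\<in>carrier \<L>. g (r \<otimes> l) = snd q r \<otimes> l)" if q: "q \<in> carrier (Q1 \<T>)" for q
  proof -
    have bim: "sup_bimorphism \<R> \<L> (Q0 \<T>) (\<lambda>r l. snd q r \<otimes> l)"
      by (rule sup_bimorphism_comp_args[OF tensor_bimorphism Q1_sup_morphism(2)[OF q]
            sup_morphism_id[OF L.M.complete_lattice_axioms]])
    have bal: "snd q (r \<lhd> t) \<otimes> l = snd q r \<otimes> (t \<rhd> l)"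
      if "r \<in> carrier \<R>" "t \<in> carrier \<S>" "l \<in> carrier \<L>" for r t l
      using that by (simp add: Q1_snd_action[OF q] tensor_balanced Q1_snd_closed[OF q])
    obtain g where "sup_morphism (Q0 \<T>) (Q0 \<T>) g"
      "\<And>r l. \<lbrakk>r \<in> carrier \<R>; l \<in> carrier \<L>\<rbrakk> \<Longrightarrow> g (r \<otimes> l) = snd q r \<otimes> l"
      using Q0_lift[OF bim bal] by blast
    then show ?thesis by (intro exI[of _ g]) simp
  qed
  then obtain a where a: "\<And>q. q \<in> carrier (Q1 \<T>) \<Longrightarrow> sup_morphism (Q0 \<T>) (Q0 \<T>) (a q)"
    "\<And>q r l. \<lbrakk>q \<in> carrier (Q1 \<T>); r \<in> carrier \<R>; l \<in> carrier \<L>\<rbrakk> \<Longrightarrow> a q (r \<otimes> l) = snd q r \<otimes> l"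
    by metis
  have "sup_bimorphism (Q1 \<T>) (Q0 \<T>) (Q0 \<T>) a"
  proof (rule sup_bimorphismI[OF Q0_sup_morphism_parameter[OF Q1_complete_lattice a(1)] a(1)])
    fix r l assume rl: "r \<in> carrier \<R>" "l \<in> carrier \<L>"
    have "sup_morphism (Q1 \<T>) (Q0 \<T>) (\<lambda>q. snd q r \<otimes> l)"
      by (rule sup_morphism_comp[OF sup_bimorphism_left[OF tensor_bimorphism rl(2)] Q1_snd_sup_morphism[OF rl(1)]])
    then show "sup_morphism (Q1 \<T>) (Q0 \<T>) (\<lambda>q. a q (r \<otimes> l))"
      by (rule sup_morphism_cong) (simp add: a(2) rl)
  qed
  then show ?thesis using a(2) by (auto simp: Q1_act_R_def)
qed

text \<open>The mirror image: balancing now comes from left \<open>T\<close>-linearity of the first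
  component. The chosen family takes the pair as its first argument, so the arguments are swapped at
  the end.\<close>

lemma Q0_right_act_exists:
  "\<exists>a. sup_bimorphism (Q0 \<T>) (Q1 \<T>) (Q0 \<T>) a \<and>
     (\<forall>r\<in>carrier \<R>. \<forall>l\<in>carrier \<L>. \<forall>q\<in>carrier (Q1 \<T>). a (r \<otimes> l) q = r \<otimes> Q1_act_L l q)"
proof -
  have "\<exists>g. sup_morphism (Q0 \<T>) (Q0 \<T>) g \<and>
      (\<forall>r\<in>carrier \<R>. \<forall>l\<in>carrier \<L>. g (r \<otimes> l) = r \<otimes> fst q l)" if q: "q \<in> carrier (Q1 \<T>)" for q
  proof -
    have bim: "sup_bimorphism \<R> \<L> (Q0 \<T>) (\<lambda>r l. r \<otimes> fst q l)"
      by (rule sup_bimorphism_comp_args[OF tensor_bimorphism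
            sup_morphism_id[OF R.M.complete_lattice_axioms] Q1_sup_morphism(1)[OF q]])
    have bal: "(r \<lhd> t) \<otimes> fst q l = r \<otimes> fst q (t \<rhd> l)"
      if "r \<in> carrier \<R>" "t \<in> carrier \<S>" "l \<in> carrier \<L>" for r t l
      using that by (simp add: Q1_fst_action[OF q] tensor_balanced Q1_fst_closed[OF q])
    obtain g where "sup_morphism (Q0 \<T>) (Q0 \<T>) g"
      "\<And>r l. \<lbrakk>r \<in> carrier \<R>; l \<in> carrier \<L>\<rbrakk> \<Longrightarrow> g (r \<otimes> l) = r \<otimes> fst q l"
      using Q0_lift[OF bim bal] by blast
    then show ?thesis by (intro exI[of _ g]) simp
  qed
  then obtain a where a: "\<And>q. q \<in> carrier (Q1 \<T>) \<Longrightarrow> sup_morphism (Q0 \<T>) (Q0 \<T>) (a q)"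
    "\<And>q r l. \<lbrakk>q \<in> carrier (Q1 \<T>); r \<in> carrier \<R>; l \<in> carrier \<L>\<rbrakk> \<Longrightarrow> a q (r \<otimes> l) = r \<otimes> fst q l"
    by metis
  have "sup_bimorphism (Q0 \<T>) (Q1 \<T>) (Q0 \<T>) (\<lambda>c q. a q c)"
  proof (rule sup_bimorphismI[OF a(1) Q0_sup_morphism_parameter[OF Q1_complete_lattice a(1)]])
    fix r l assume rl: "r \<in> carrier \<R>" "l \<in> carrier \<L>"
    have "sup_morphism (Q1 \<T>) (Q0 \<T>) (\<lambda>q. r \<otimes> fst q l)"
      by (rule sup_morphism_comp[OF sup_bimorphism_right[OF tensor_bimorphism rl(1)] Q1_fst_sup_morphism[OF rl(2)]])
    then show "sup_morphism (Q1 \<T>) (Q0 \<T>) (\<lambda>q. a q (r \<otimes> l))"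
      by (rule sup_morphism_cong) (simp add: a(2) rl)
  qed
  then show ?thesis
    using a(2) by (intro exI[of _ "\<lambda>c q. a q c"]) (simp add: Q1_act_L_def)
qed

abbreviation (input) left_act (infixr "\<bullet>" 75) where "q \<bullet> c \<equiv> Q0_left_act \<T> q c"
abbreviation (input) right_act (infixl "\<star>" 75) where "c \<star> q \<equiv> Q0_right_act \<T> c q"

text \<open>The action is a chosen map; this fact and its values on tensors are all that later
  arguments use about it.\<close>

lemma Q0_left_act_bimorphism: "sup_bimorphism (Q1 \<T>) (Q0 \<T>) (Q0 \<T>) (Q0_left_act \<T>)"
  using someI_ex[OF Q0_left_act_exists] unfolding Q0_left_act_def by blast

lemma Q0_left_act_tensor:
  "\<lbrakk>q \<in> carrier (Q1 \<T>); r \<in> carrier \<R>; l \<in> carrier \<L>\<rbrakk> \<Longrightarrow> q \<bullet> (r \<otimes> l) = snd q r \<otimes> l"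
  using someI_ex[OF Q0_left_act_exists] unfolding Q0_left_act_def Q1_act_R_def by blast

lemma Q0_right_act_bimorphism: "sup_bimorphism (Q0 \<T>) (Q1 \<T>) (Q0 \<T>) (Q0_right_act \<T>)"
  using someI_ex[OF Q0_right_act_exists] unfolding Q0_right_act_def by blast

lemma Q0_right_act_tensor:
  "\<lbrakk>r \<in> carrier \<R>; l \<in> carrier \<L>; q \<in> carrier (Q1 \<T>)\<rbrakk> \<Longrightarrow> (r \<otimes> l) \<star> q = r \<otimes> fst q l"
  using someI_ex[OF Q0_right_act_exists] unfolding Q0_right_act_def Q1_act_L_def by blast

end

section \<open>The couple of a triad\<close>

context triad
begin

text \<open>The value prescribed for \<open>\<phi>\<close> on a tensor, an analogue of the rank-one
  operators of linear algebra.\<close>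

definition rank_one :: "'r \<Rightarrow> 'l \<Rightarrow> ('l \<Rightarrow> 'l) \<times> ('r \<Rightarrow> 'r)" where
  "rank_one r l = (\<lambda>l'\<in>carrier \<L>. \<langle>l', r\<rangle> \<rhd> l, \<lambda>r'\<in>carrier \<R>. r \<lhd> \<langle>l, r'\<rangle>)"

lemma rank_one_apply:
  "l' \<in> carrier \<L> \<Longrightarrow> fst (rank_one r l) l' = \<langle>l', r\<rangle> \<rhd> l"
  "r' \<in> carrier \<R> \<Longrightarrow> snd (rank_one r l) r' = r \<lhd> \<langle>l, r'\<rangle>"
  by (simp_all add: rank_one_def)

text \<open>The first statement is used for membership of \<open>rank_one r l\<close> in
  \<open>Q1\<close>, the other two for its dependence on \<open>r\<close> and
  \<open>l\<close>.\<close>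

lemma fst_rank_one_sup_morphisms:
  "\<lbrakk>r \<in> carrier \<R>; l \<in> carrier \<L>\<rbrakk> \<Longrightarrow> sup_morphism \<L> \<L> (\<lambda>l'. \<langle>l', r\<rangle> \<rhd> l)"
  "\<lbrakk>l' \<in> carrier \<L>; l \<in> carrier \<L>\<rbrakk> \<Longrightarrow> sup_morphism \<R> \<L> (\<lambda>r. \<langle>l', r\<rangle> \<rhd> l)"
  "\<lbrakk>l' \<in> carrier \<L>; r \<in> carrier \<R>\<rbrakk> \<Longrightarrow> sup_morphism \<L> \<L> (\<lambda>l. \<langle>l', r\<rangle> \<rhd> l)"
  by (rule sup_morphism_comp[OF sup_bimorphism_left[OF L.left_action_bimorphism]
        sup_bimorphism_left[OF pairing_bimorphism]], assumption+,
      rule sup_morphism_comp[OF sup_bimorphism_left[OF L.left_action_bimorphism]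
        sup_bimorphism_right[OF pairing_bimorphism]], assumption+,
      rule sup_bimorphism_right[OF L.left_action_bimorphism pair_closed])

lemma snd_rank_one_sup_morphisms:
  "\<lbrakk>r \<in> carrier \<R>; l \<in> carrier \<L>\<rbrakk> \<Longrightarrow> sup_morphism \<R> \<R> (\<lambda>r'. r \<lhd> \<langle>l, r'\<rangle>)"
  "\<lbrakk>r \<in> carrier \<R>; r' \<in> carrier \<R>\<rbrakk> \<Longrightarrow> sup_morphism \<L> \<R> (\<lambda>l. r \<lhd> \<langle>l, r'\<rangle>)"
  "\<lbrakk>l \<in> carrier \<L>; r' \<in> carrier \<R>\<rbrakk> \<Longrightarrow> sup_morphism \<R> \<R> (\<lambda>r. r \<lhd> \<langle>l, r'\<rangle>)"
  by (rule sup_morphism_comp[OF sup_bimorphism_right[OF R.right_action_bimorphism]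
        sup_bimorphism_right[OF pairing_bimorphism]], assumption+,
      rule sup_morphism_comp[OF sup_bimorphism_right[OF R.right_action_bimorphism]
        sup_bimorphism_left[OF pairing_bimorphism]], assumption+,
      rule sup_bimorphism_left[OF R.right_action_bimorphism pair_closed])

text \<open>Adjointness is the computation
  \<open>((l' r) l) r' = (l' r)(l r') = l' (r (l r'))\<close>, one equation for each compatibility
  law of the pairing.\<close>

lemma rank_one_closed:
  assumes r: "r \<in> carrier \<R>" and l: "l \<in> carrier \<L>"
  shows "rank_one r l \<in> carrier (Q1 \<T>)"
  unfolding rank_one_def
proof (rule Q1I)
  show "sup_morphism \<L> \<L> (\<lambda>l'\<in>carrier \<L>. \<langle>l', r\<rangle> \<rhd> l)"
    by (rule sup_morphism_cong[OF fst_rank_one_sup_morphisms(1)[OF r l]]) simp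
  show "sup_morphism \<R> \<R> (\<lambda>r'\<in>carrier \<R>. r \<lhd> \<langle>l, r'\<rangle>)"
    by (rule sup_morphism_cong[OF snd_rank_one_sup_morphisms(1)[OF r l]]) simp
qed (use r l in \<open>simp_all add: action_closed pairing_left L.left_action_assoc
    R.right_action_assoc flip: pairing_right\<close>)

lemma rank_one_bimorphism: "sup_bimorphism \<R> \<L> (Q1 \<T>) rank_one"
proof (rule sup_bimorphismI)
  show "sup_morphism \<R> (Q1 \<T>) (\<lambda>r. rank_one r l)" if "l \<in> carrier \<L>" for l
    using that by (intro Q1_sup_morphismI R.M.complete_lattice_axioms rank_one_closed)
      (simp_all add: rank_one_apply fst_rank_one_sup_morphisms snd_rank_one_sup_morphisms)
  show "sup_morphism \<L> (Q1 \<T>) (\<lambda>l. rank_one r l)" if "r \<in> carrier \<R>" for r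
    using that by (intro Q1_sup_morphismI L.M.complete_lattice_axioms rank_one_closed)
      (simp_all add: rank_one_apply fst_rank_one_sup_morphisms snd_rank_one_sup_morphisms)
qed

text \<open>The components agree by \<open>(l' (r t)) l = ((l' r) t) l = (l' r)(t l)\<close> and
  \<open>(r t)(l r') = r (t (l r')) = r ((t l) r')\<close>.\<close>

lemma rank_one_balanced:
  assumes "r \<in> carrier \<R>" "t \<in> carrier \<S>" "l \<in> carrier \<L>"
  shows "rank_one (r \<lhd> t) l = rank_one r (t \<rhd> l)"
  using assms
  by (intro Q1_eqI rank_one_closed) (simp_all add: rank_one_apply action_closed pairing_left
      L.left_action_assoc R.right_action_assoc flip: pairing_right)

lemma extends_triad_assignment_iff:
  "extends_triad_assignment \<T> \<phi> \<longleftrightarrow>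
     \<phi> \<in> extensional (carrier (Q0 \<T>)) \<and> sup_morphism (Q0 \<T>) (Q1 \<T>) \<phi> \<and>
     (\<forall>r\<in>carrier \<R>. \<forall>l\<in>carrier \<L>. \<phi> (r \<otimes> l) = rank_one r l)"
  by (simp only: extends_triad_assignment_def rank_one_def)

lemma extends_triad_assignment_ex1: "\<exists>!\<phi>. extends_triad_assignment \<T> \<phi>"
proof (rule ex_ex1I)
  obtain g where g: "sup_morphism (Q0 \<T>) (Q1 \<T>) g"
    "\<And>r l. \<lbrakk>r \<in> carrier \<R>; l \<in> carrier \<L>\<rbrakk> \<Longrightarrow> g (r \<otimes> l) = rank_one r l"
    using Q0_lift[OF rank_one_bimorphism rank_one_balanced] by blast
  \<comment> \<open>The lift is arbitrary outside the carrier; restricting it meets the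
    extensionality demand, which is also what makes \<open>\<phi>\<close> unique as a
    function.\<close>
  have "sup_morphism (Q0 \<T>) (Q1 \<T>) (restrict g (carrier (Q0 \<T>)))"
    by (rule sup_morphism_cong[OF g(1)]) simp
  moreover have "restrict g (carrier (Q0 \<T>)) (r \<otimes> l) = rank_one r l"
    if "r \<in> carrier \<R>" "l \<in> carrier \<L>" for r l
    using g(2)[OF that] tensor_closed[OF that] by simp
  ultimately show "\<exists>\<phi>. extends_triad_assignment \<T> \<phi>"
    by (intro exI[of _ "restrict g (carrier (Q0 \<T>))"]) (simp add: extends_triad_assignment_iff)
next
  fix \<phi> \<psi> assume ext: "extends_triad_assignment \<T> \<phi>" "extends_triad_assignment \<T> \<psi>"
  show "\<phi> = \<psi>"
  proof (rule extensionalityI)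
    show "\<phi> \<in> extensional (carrier (Q0 \<T>))" "\<psi> \<in> extensional (carrier (Q0 \<T>))"
      using ext by (simp_all only: extends_triad_assignment_iff)
    show "\<phi> c = \<psi> c" if "c \<in> carrier (Q0 \<T>)" for c
      by (rule Q0_eqI[where C = "Q1 \<T>", OF _ _ _ that]) (use ext in \<open>simp_all add: extends_triad_assignment_iff\<close>)
  qed
qed

end

locale triad_coupling = triad +
  fixes \<phi>
  assumes extends: "extends_triad_assignment \<T> \<phi>"
begin

lemma coupling_sup_morphism: "sup_morphism (Q0 \<T>) (Q1 \<T>) \<phi>"
  using extends by (simp add: extends_triad_assignment_iff)

lemma coupling_tensor:
  "\<lbrakk>r \<in> carrier \<R>; l \<in> carrier \<L>\<rbrakk> \<Longrightarrow> \<phi> (r \<otimes> l) = rank_one r l"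
  using extends by (simp add: extends_triad_assignment_iff)

lemma coupling_closed: "c \<in> carrier (Q0 \<T>) \<Longrightarrow> \<phi> c \<in> carrier (Q1 \<T>)"
  by (rule sup_morphism_closed[OF coupling_sup_morphism])

text \<open>The product of \<open>Q\<^sub>0\<close> is the left action of \<open>Q\<^sub>1\<close> restricted along \<open>\<phi>\<close>.\<close>

lemma Q0_mult_exists:
  "\<exists>m. sup_bimorphism (balanced_tensor \<T>) (balanced_tensor \<T>) (balanced_tensor \<T>) m \<and>
     (\<forall>r\<in>carrier \<R>. \<forall>l\<in>carrier \<L>. \<forall>r'\<in>carrier \<R>. \<forall>l'\<in>carrier \<L>.
        m (r \<otimes> l) (r' \<otimes> l') = (r \<lhd> \<langle>l, r'\<rangle>) \<otimes> l')"
proof (intro exI conjI ballI)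
  show "sup_bimorphism (balanced_tensor \<T>) (balanced_tensor \<T>) (balanced_tensor \<T>) (\<lambda>c d. \<phi> c \<bullet> d)"
    using sup_bimorphism_comp_args[OF Q0_left_act_bimorphism coupling_sup_morphism
        sup_morphism_id[OF Q0_complete_lattice]]
    by (simp add: sup_bimorphism_def balanced_sup_morphism_iff)
  fix r l r' l'
  assume "r \<in> carrier \<R>" "l \<in> carrier \<L>" "r' \<in> carrier \<R>" "l' \<in> carrier \<L>"
  then show "\<phi> (r \<otimes> l) \<bullet> (r' \<otimes> l') = (r \<lhd> \<langle>l, r'\<rangle>) \<otimes> l'"
    by (simp add: coupling_tensor Q0_left_act_tensor rank_one_closed rank_one_apply)
qed

lemma Q0_mult_bimorphism: "sup_bimorphism (Q0 \<T>) (Q0 \<T>) (Q0 \<T>) (qmult (Q0 \<T>))"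
  using someI_ex[OF Q0_mult_exists, folded Q0_mult_def]
  by (simp add: sup_bimorphism_def balanced_sup_morphism_iff)

lemma Q0_mult_tensor:
  "\<lbrakk>r \<in> carrier \<R>; l \<in> carrier \<L>; r' \<in> carrier \<R>; l' \<in> carrier \<L>\<rbrakk> \<Longrightarrow>
     (r \<otimes> l) \<cdot>\<^bsub>Q0 \<T>\<^esub> (r' \<otimes> l') = (r \<lhd> \<langle>l, r'\<rangle>) \<otimes> l'"
  using someI_ex[OF Q0_mult_exists, folded Q0_mult_def] by simp

lemma Q0_eqI2:
  assumes f: "sup_bimorphism (Q0 \<T>) (Q0 \<T>) C f" and g: "sup_bimorphism (Q0 \<T>) (Q0 \<T>) C g"
    and eq: "\<And>r l r' l'. \<lbrakk>r \<in> carrier \<R>; l \<in> carrier \<L>; r' \<in> carrier \<R>; l' \<in> carrier \<L>\<rbrakk> \<Longrightarrow>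
       f (r \<otimes> l) (r' \<otimes> l') = g (r \<otimes> l) (r' \<otimes> l')"
    and c: "c \<in> carrier (Q0 \<T>)" and d: "d \<in> carrier (Q0 \<T>)"
  shows "f c d = g c d"
proof (rule Q0_eqI[OF sup_bimorphism_left[OF f d] sup_bimorphism_left[OF g d] _ c])
  fix r l assume rl: "r \<in> carrier \<R>" "l \<in> carrier \<L>"
  show "f (r \<otimes> l) d = g (r \<otimes> l) d"
    by (rule Q0_eqI[OF sup_bimorphism_right[OF f] sup_bimorphism_right[OF g] _ d])
      (simp_all only: rl eq tensor_closed)
qed

text \<open>Existence of a product was shown with this very formula, but \<open>Q0_mult\<close> is
  whichever map the choice returned; the two are identified through their values on tensors.\<close>

lemma Q0_mult_eq_left_act:
  "\<lbrakk>c \<in> carrier (Q0 \<T>); d \<in> carrier (Q0 \<T>)\<rbrakk> \<Longrightarrow> c \<cdot>\<^bsub>Q0 \<T>\<^esub> d = \<phi> c \<bullet> d"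
  by (rule Q0_eqI2[OF Q0_mult_bimorphism sup_bimorphism_comp_args[OF Q0_left_act_bimorphism
          coupling_sup_morphism sup_morphism_id[OF Q0_complete_lattice]]])
    (simp_all only: Q0_mult_tensor coupling_tensor Q0_left_act_tensor rank_one_closed rank_one_apply)

text \<open>On tensors the product is \<open>(r (l r')) \<otimes> l'\<close> while the right action
  gives \<open>r \<otimes> ((l r') l')\<close>. Balancing over \<open>T\<close> makes these
  equal.\<close>

lemma Q0_mult_eq_right_act:
  "\<lbrakk>c \<in> carrier (Q0 \<T>); d \<in> carrier (Q0 \<T>)\<rbrakk> \<Longrightarrow> c \<cdot>\<^bsub>Q0 \<T>\<^esub> d = c \<star> \<phi> d"
  by (rule Q0_eqI2[OF Q0_mult_bimorphism sup_bimorphism_comp_args[OF Q0_right_act_bimorphism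
          sup_morphism_id[OF Q0_complete_lattice] coupling_sup_morphism]])
    (simp_all only: Q0_mult_tensor coupling_tensor Q0_right_act_tensor rank_one_closed
      rank_one_apply tensor_balanced pair_closed)

section \<open>\<open>Q0\<close> as a bimodule over \<open>Q1\<close> and linearity of
  \<open>\<phi>\<close>\<close>

lemma Q0_left_act_morphism:
  "q \<in> carrier (Q1 \<T>) \<Longrightarrow> sup_morphism (Q0 \<T>) (Q0 \<T>) (\<lambda>c. q \<bullet> c)"
  by (rule sup_bimorphism_right[OF Q0_left_act_bimorphism])

lemma Q0_right_act_morphism:
  "q \<in> carrier (Q1 \<T>) \<Longrightarrow> sup_morphism (Q0 \<T>) (Q0 \<T>) (\<lambda>c. c \<star> q)"
  by (rule sup_bimorphism_left[OF Q0_right_act_bimorphism])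

lemma Q0_act_closed:
  "\<lbrakk>q \<in> carrier (Q1 \<T>); c \<in> carrier (Q0 \<T>)\<rbrakk> \<Longrightarrow> q \<bullet> c \<in> carrier (Q0 \<T>)"
  "\<lbrakk>c \<in> carrier (Q0 \<T>); q \<in> carrier (Q1 \<T>)\<rbrakk> \<Longrightarrow> c \<star> q \<in> carrier (Q0 \<T>)"
  by (rule sup_bimorphism_closed[OF Q0_left_act_bimorphism],
      assumption+, rule sup_bimorphism_closed[OF Q0_right_act_bimorphism])

lemma Q0_left_act_assoc:
  assumes p: "p \<in> carrier (Q1 \<T>)" and q: "q \<in> carrier (Q1 \<T>)" and c: "c \<in> carrier (Q0 \<T>)"
  shows "(p \<cdot>\<^bsub>Q1 \<T>\<^esub> q) \<bullet> c = p \<bullet> (q \<bullet> c)"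
  by (rule Q0_eqI[OF Q0_left_act_morphism[OF Q1_qmult_closed[OF p q]]
        sup_morphism_comp[OF Q0_left_act_morphism[OF p] Q0_left_act_morphism[OF q]] _ c])
    (simp only: Q0_left_act_tensor Q1_qmult_closed Q1_qmult_apply Q1_closed p q)

lemma Q0_right_act_assoc:
  assumes p: "p \<in> carrier (Q1 \<T>)" and q: "q \<in> carrier (Q1 \<T>)" and c: "c \<in> carrier (Q0 \<T>)"
  shows "c \<star> (p \<cdot>\<^bsub>Q1 \<T>\<^esub> q) = (c \<star> p) \<star> q"
  by (rule Q0_eqI[OF Q0_right_act_morphism[OF Q1_qmult_closed[OF p q]]
        sup_morphism_comp[OF Q0_right_act_morphism[OF q] Q0_right_act_morphism[OF p]] _ c])
    (simp only: Q0_right_act_tensor Q1_qmult_closed Q1_qmult_apply Q1_closed p q)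

text \<open>On a tensor the left action changes only \<open>r\<close> and the right action only
  \<open>l\<close>.\<close>

lemma Q0_actions_commute:
  assumes p: "p \<in> carrier (Q1 \<T>)" and q: "q \<in> carrier (Q1 \<T>)" and c: "c \<in> carrier (Q0 \<T>)"
  shows "(p \<bullet> c) \<star> q = p \<bullet> (c \<star> q)"
  by (rule Q0_eqI[OF sup_morphism_comp[OF Q0_right_act_morphism[OF q] Q0_left_act_morphism[OF p]]
        sup_morphism_comp[OF Q0_left_act_morphism[OF p] Q0_right_act_morphism[OF q]] _ c])
    (simp only: Q0_left_act_tensor Q0_right_act_tensor Q1_closed p q)

text \<open>For \<open>q = (\<alpha>, \<beta>)\<close> and a tensor, the first components agree by
  adjointness, \<open>(l' \<beta>(r)) l = (\<alpha>(l') r) l\<close>, and the second by right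
  linearity, \<open>\<beta>(r) (l r') = \<beta>(r (l r'))\<close>.\<close>

lemma coupling_left_act:
  assumes q: "q \<in> carrier (Q1 \<T>)" and c: "c \<in> carrier (Q0 \<T>)"
  shows "\<phi> (q \<bullet> c) = q \<cdot>\<^bsub>Q1 \<T>\<^esub> \<phi> c"
proof (rule Q0_eqI[OF sup_morphism_comp[OF coupling_sup_morphism Q0_left_act_morphism[OF q]]
      sup_morphism_comp[OF sup_bimorphism_right[OF quantale.qmult_bimorphism[OF Q1_quantale] q]
        coupling_sup_morphism] _ c])
  fix r l assume rl: "r \<in> carrier \<R>" "l \<in> carrier \<L>"
  show "\<phi> (q \<bullet> (r \<otimes> l)) = q \<cdot>\<^bsub>Q1 \<T>\<^esub> \<phi> (r \<otimes> l)"
    using rl q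
    by (simp add: Q0_left_act_tensor coupling_tensor Q1_closed,
        intro Q1_eqI Q1_qmult_closed rank_one_closed)
      (simp_all add: rank_one_apply Q1_qmult_apply Q1_closed Q1_adjoint Q1_snd_action pair_closed)
qed

text \<open>The roles are exchanged: left linearity of \<open>\<alpha>\<close> settles the first
  component and adjointness the second.\<close>

lemma coupling_right_act:
  assumes q: "q \<in> carrier (Q1 \<T>)" and c: "c \<in> carrier (Q0 \<T>)"
  shows "\<phi> (c \<star> q) = \<phi> c \<cdot>\<^bsub>Q1 \<T>\<^esub> q"
proof (rule Q0_eqI[OF sup_morphism_comp[OF coupling_sup_morphism Q0_right_act_morphism[OF q]]
      sup_morphism_comp[OF sup_bimorphism_left[OF quantale.qmult_bimorphism[OF Q1_quantale] q]
        coupling_sup_morphism] _ c])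
  fix r l assume rl: "r \<in> carrier \<R>" "l \<in> carrier \<L>"
  show "\<phi> ((r \<otimes> l) \<star> q) = \<phi> (r \<otimes> l) \<cdot>\<^bsub>Q1 \<T>\<^esub> q"
    using rl q
    by (simp add: Q0_right_act_tensor coupling_tensor Q1_closed,
        intro Q1_eqI Q1_qmult_closed rank_one_closed)
      (simp_all add: rank_one_apply Q1_qmult_apply Q1_closed Q1_adjoint Q1_fst_action pair_closed)
qed

lemma Q0_qmult_closed:
  "\<lbrakk>c \<in> carrier (Q0 \<T>); d \<in> carrier (Q0 \<T>)\<rbrakk> \<Longrightarrow> c \<cdot>\<^bsub>Q0 \<T>\<^esub> d \<in> carrier (Q0 \<T>)"
  by (rule sup_bimorphism_closed[OF Q0_mult_bimorphism])

lemma coupling_mult: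
  assumes c: "c \<in> carrier (Q0 \<T>)" and d: "d \<in> carrier (Q0 \<T>)"
  shows "\<phi> (c \<cdot>\<^bsub>Q0 \<T>\<^esub> d) = \<phi> c \<cdot>\<^bsub>Q1 \<T>\<^esub> \<phi> d"
  unfolding Q0_mult_eq_left_act[OF c d] by (rule coupling_left_act[OF coupling_closed[OF c] d])

lemma Q0_quantale: "quantale (Q0 \<T>)"
proof
  show "sup_bimorphism (Q0 \<T>) (Q0 \<T>) (Q0 \<T>) (qmult (Q0 \<T>))" by (rule Q0_mult_bimorphism)
  fix b c d assume b: "b \<in> carrier (Q0 \<T>)" and c: "c \<in> carrier (Q0 \<T>)" and d: "d \<in> carrier (Q0 \<T>)"
  have "(b \<cdot>\<^bsub>Q0 \<T>\<^esub> c) \<cdot>\<^bsub>Q0 \<T>\<^esub> d = (\<phi> b \<cdot>\<^bsub>Q1 \<T>\<^esub> \<phi> c) \<bullet> d"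
    unfolding Q0_mult_eq_left_act[OF Q0_qmult_closed[OF b c] d] coupling_mult[OF b c] ..
  also have "\<dots> = \<phi> b \<bullet> (\<phi> c \<bullet> d)"
    by (rule Q0_left_act_assoc[OF coupling_closed[OF b] coupling_closed[OF c] d])
  also have "\<dots> = b \<cdot>\<^bsub>Q0 \<T>\<^esub> (c \<cdot>\<^bsub>Q0 \<T>\<^esub> d)"
    unfolding Q0_mult_eq_left_act[OF c d]
      Q0_mult_eq_left_act[OF b Q0_act_closed(1)[OF coupling_closed[OF c] d]] ..
  finally show "(b \<cdot>\<^bsub>Q0 \<T>\<^esub> c) \<cdot>\<^bsub>Q0 \<T>\<^esub> d = b \<cdot>\<^bsub>Q0 \<T>\<^esub> (c \<cdot>\<^bsub>Q0 \<T>\<^esub> d)" .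
qed

text \<open>Couples on \<open>Q\<^sub>0\<close> are obtained by restricting scalars along a morphism into \<open>Q\<^sub>1\<close>; the
  identity gives the couple of the triad.\<close>

lemma restricted_couple:
  assumes K: "quantale K" and \<psi>: "quantale_morphism K (Q1 \<T>) \<psi>"
    and \<phi>0: "sup_morphism (Q0 \<T>) K \<phi>0"
    and factor: "\<And>c. c \<in> carrier (Q0 \<T>) \<Longrightarrow> \<psi> (\<phi>0 c) = \<phi> c"
    and left: "\<And>k r l. \<lbrakk>k \<in> carrier K; r \<in> carrier \<R>; l \<in> carrier \<L>\<rbrakk> \<Longrightarrow>
      \<phi>0 (snd (\<psi> k) r \<otimes> l) = k \<cdot>\<^bsub>K\<^esub> \<phi>0 (r \<otimes> l)"
    and right: "\<And>k r l. \<lbrakk>k \<in> carrier K; r \<in> carrier \<R>; l \<in> carrier \<L>\<rbrakk> \<Longrightarrow>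
      \<phi>0 (r \<otimes> fst (\<psi> k) l) = \<phi>0 (r \<otimes> l) \<cdot>\<^bsub>K\<^esub> k"
  shows "couple (Q0 \<T>) K (\<lambda>k c. \<psi> k \<bullet> c) (\<lambda>c k. c \<star> \<psi> k) \<phi>0"
proof -
  interpret K: quantale K by fact
  interpret C: quantale "Q0 \<T>" by (rule Q0_quantale)
  have \<psi>_sup: "sup_morphism K (Q1 \<T>) \<psi>"
    and \<psi>_mult: "\<And>k k'. \<lbrakk>k \<in> carrier K; k' \<in> carrier K\<rbrakk> \<Longrightarrow> \<psi> (k \<cdot>\<^bsub>K\<^esub> k') = \<psi> k \<cdot>\<^bsub>Q1 \<T>\<^esub> \<psi> k'"
    using \<psi> by (simp_all add: quantale_morphism_def)
  have \<psi>_closed: "\<psi> k \<in> carrier (Q1 \<T>)" if "k \<in> carrier K" for k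
    using \<psi>_sup that by (rule sup_morphism_closed)
  have \<phi>0_closed: "\<phi>0 c \<in> carrier K" if "c \<in> carrier (Q0 \<T>)" for c
    using \<phi>0 that by (rule sup_morphism_closed)
  \<comment> \<open>The hypothesis \<open>left\<close> concerns tensors only; both sides preserve
    joins in \<open>c\<close>, which extends it to all of \<open>Q0\<close>.\<close>
  have left_morphism: "\<phi>0 (\<psi> k \<bullet> c) = k \<cdot>\<^bsub>K\<^esub> \<phi>0 c"
    if k: "k \<in> carrier K" and c: "c \<in> carrier (Q0 \<T>)" for k c
    by (rule Q0_eqI[OF sup_morphism_comp[OF \<phi>0 Q0_left_act_morphism[OF \<psi>_closed[OF k]]]
          sup_morphism_comp[OF sup_bimorphism_right[OF K.qmult_bimorphism k] \<phi>0] _ c])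
      (simp only: Q0_left_act_tensor \<psi>_closed k left)
  have right_morphism: "\<phi>0 (c \<star> \<psi> k) = \<phi>0 c \<cdot>\<^bsub>K\<^esub> k"
    if k: "k \<in> carrier K" and c: "c \<in> carrier (Q0 \<T>)" for k c
    by (rule Q0_eqI[OF sup_morphism_comp[OF \<phi>0 Q0_right_act_morphism[OF \<psi>_closed[OF k]]]
          sup_morphism_comp[OF sup_bimorphism_left[OF K.qmult_bimorphism k] \<phi>0] _ c])
      (simp only: Q0_right_act_tensor \<psi>_closed k right)
  have coupling: "c \<cdot>\<^bsub>Q0 \<T>\<^esub> d = \<psi> (\<phi>0 c) \<bullet> d" "c \<cdot>\<^bsub>Q0 \<T>\<^esub> d = c \<star> \<psi> (\<phi>0 d)"
    if c: "c \<in> carrier (Q0 \<T>)" and d: "d \<in> carrier (Q0 \<T>)" for c d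
    unfolding factor[OF c] factor[OF d]
    by (rule Q0_mult_eq_left_act[OF c d], rule Q0_mult_eq_right_act[OF c d])
  \<comment> \<open>Multiplicativity is not assumed of \<open>\<phi>0\<close>: the product is the
    action of \<open>\<psi> (\<phi>0 c)\<close> on \<open>d\<close>, so left linearity with scalar
    \<open>\<phi>0 c\<close> gives it.\<close>
  have mult: "\<phi>0 (c \<cdot>\<^bsub>Q0 \<T>\<^esub> d) = \<phi>0 c \<cdot>\<^bsub>K\<^esub> \<phi>0 d"
    if c: "c \<in> carrier (Q0 \<T>)" and d: "d \<in> carrier (Q0 \<T>)" for c d
    unfolding coupling(1)[OF c d] by (rule left_morphism[OF \<phi>0_closed[OF c] d])
  have left_bim: "sup_bimorphism K (Q0 \<T>) (Q0 \<T>) (\<lambda>k c. \<psi> k \<bullet> c)"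
    by (rule sup_bimorphism_comp_args[OF Q0_left_act_bimorphism \<psi>_sup sup_morphism_id[OF Q0_complete_lattice]])
  have right_bim: "sup_bimorphism (Q0 \<T>) K (Q0 \<T>) (\<lambda>c k. c \<star> \<psi> k)"
    by (rule sup_bimorphism_comp_args[OF Q0_right_act_bimorphism sup_morphism_id[OF Q0_complete_lattice] \<psi>_sup])
  show ?thesis
  proof
    show "sup_bimorphism K (Q0 \<T>) (Q0 \<T>) (\<lambda>k c. \<psi> k \<bullet> c)" by fact
    show "sup_bimorphism (Q0 \<T>) K (Q0 \<T>) (\<lambda>c k. c \<star> \<psi> k)" by fact
    show "quantale_morphism (Q0 \<T>) K \<phi>0"
      unfolding quantale_morphism_def using \<phi>0 mult by blast
    show "left_module_morphism K (Q0 \<T>) (\<lambda>k c. \<psi> k \<bullet> c) K (qmult K) \<phi>0"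
      unfolding left_module_morphism_def using \<phi>0 left_morphism by blast
    show "right_module_morphism K (Q0 \<T>) (\<lambda>c k. c \<star> \<psi> k) K (qmult K) \<phi>0"
      unfolding right_module_morphism_def using \<phi>0 right_morphism by blast
    fix p q c assume pq: "p \<in> carrier K" "q \<in> carrier K" and c: "c \<in> carrier (Q0 \<T>)"
    show "\<psi> (p \<cdot>\<^bsub>K\<^esub> q) \<bullet> c = \<psi> p \<bullet> (\<psi> q \<bullet> c)" "c \<star> \<psi> (p \<cdot>\<^bsub>K\<^esub> q) = (c \<star> \<psi> p) \<star> \<psi> q"
      "(\<psi> p \<bullet> c) \<star> \<psi> q = \<psi> p \<bullet> (c \<star> \<psi> q)"
      using pq c by (simp_all only: \<psi>_mult \<psi>_closed Q0_left_act_assoc Q0_right_act_assoc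
          Q0_actions_commute)
  qed (fact coupling)+
qed

lemma triad_unital_couple: "unital_couple (Q0 \<T>) (Q1 \<T>) (Q0_left_act \<T>) (Q0_right_act \<T>) \<phi>"
proof -
  have "couple (Q0 \<T>) (Q1 \<T>) (\<lambda>q c. q \<bullet> c) (\<lambda>c q. c \<star> q) \<phi>"
  proof (rule restricted_couple[OF Q1_quantale _ coupling_sup_morphism])
    show "quantale_morphism (Q1 \<T>) (Q1 \<T>) (\<lambda>q. q)"
      by (simp add: quantale_morphism_def sup_morphism_id Q1_complete_lattice)
    fix q r l assume "q \<in> carrier (Q1 \<T>)" "r \<in> carrier \<R>" "l \<in> carrier \<L>"
    then show "\<phi> (snd q r \<otimes> l) = q \<cdot>\<^bsub>Q1 \<T>\<^esub> \<phi> (r \<otimes> l)" "\<phi> (r \<otimes> fst q l) = \<phi> (r \<otimes> l) \<cdot>\<^bsub>Q1 \<T>\<^esub> q"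
      by (simp_all only: coupling_left_act[symmetric] coupling_right_act[symmetric] tensor_closed
          Q0_left_act_tensor Q0_right_act_tensor)
  qed simp
  then interpret couple "Q0 \<T>" "Q1 \<T>" "Q0_left_act \<T>" "Q0_right_act \<T>" \<phi> by simp
  show ?thesis
  proof
    have "Q1_one \<bullet> c = c" if c: "c \<in> carrier (Q0 \<T>)" for c
      by (rule Q0_eqI[OF Q0_left_act_morphism[OF Q1_one_closed] sup_morphism_id[OF Q0_complete_lattice] _ c])
        (simp add: Q0_left_act_tensor Q1_one_closed, simp add: Q1_one_def)
    moreover have "c \<star> Q1_one = c" if c: "c \<in> carrier (Q0 \<T>)" for c
      by (rule Q0_eqI[OF Q0_right_act_morphism[OF Q1_one_closed] sup_morphism_id[OF Q0_complete_lattice] _ c])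
        (simp add: Q0_right_act_tensor Q1_one_closed, simp add: Q1_one_def)
    ultimately show "\<exists>e. is_unit (Q1 \<T>) e \<and> (\<forall>c\<in>carrier (Q0 \<T>). e \<bullet> c = c \<and> c \<star> e = c)"
      using Q1_one_unit by blast
  qed
qed

section \<open>Solutions and couple factorizations\<close>

text \<open>Each axiom of a solution has its own task. Commuting actions and
  \<open>pairing_balanced\<close> put \<open>\<psi> q\<close> into \<open>Q1\<close>; associativity
  of the actions makes \<open>\<psi>\<close> multiplicative; \<open>rl_balanced\<close> yields
  \<open>\<phi>0\<close>; \<open>rl_act_R\<close> and \<open>rl_act_L\<close> are the two components
  of \<open>\<psi> (\<phi>0 c) = \<phi> c\<close> on tensors; \<open>rl_left\<close> and
  \<open>rl_right\<close> are the linearity required by \<open>restricted_couple\<close>.\<close>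

lemma solution_factorization:
  assumes "triad_solution \<T> Q la ra rl"
  shows "\<exists>\<phi>0 \<phi>1. couple_factorization (Q0 \<T>) (Q1 \<T>) (Q0_left_act \<T>) (Q0_right_act \<T>) \<phi> Q \<phi>0 \<phi>1"
proof -
  interpret S: triad_solution \<T> Q la ra rl by fact
  note la = S.QR.left.left_action_bimorphism and ra = S.LQ.right.right_action_bimorphism
  define \<psi> where "\<psi> q = (\<lambda>l\<in>carrier \<L>. ra l q, \<lambda>r\<in>carrier \<R>. la q r)" for q
  have fst_\<psi>: "l \<in> carrier \<L> \<Longrightarrow> fst (\<psi> q) l = ra l q"
    and snd_\<psi>: "r \<in> carrier \<R> \<Longrightarrow> snd (\<psi> q) r = la q r" for q l r
    by (simp_all add: \<psi>_def)
  have la_closed: "la q r \<in> carrier \<R>" if "q \<in> carrier Q" "r \<in> carrier \<R>" for q r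
    using la that by (rule sup_bimorphism_closed)
  have ra_closed: "ra l q \<in> carrier \<L>" if "l \<in> carrier \<L>" "q \<in> carrier Q" for l q
    using ra that by (rule sup_bimorphism_closed)
  have rl_closed: "rl r l \<in> carrier Q" if "r \<in> carrier \<R>" "l \<in> carrier \<L>" for r l
    using S.rl_bimorphism that by (rule sup_bimorphism_closed)
  have \<psi>_closed: "\<psi> q \<in> carrier (Q1 \<T>)" if q: "q \<in> carrier Q" for q
    unfolding \<psi>_def
  proof (rule Q1I)
    show "sup_morphism \<L> \<L> (\<lambda>l\<in>carrier \<L>. ra l q)"
      by (rule sup_morphism_cong[OF sup_bimorphism_left[OF ra q]]) simp
    show "sup_morphism \<R> \<R> (\<lambda>r\<in>carrier \<R>. la q r)"
      by (rule sup_morphism_cong[OF sup_bimorphism_right[OF la q]]) simp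
  qed (simp_all add: q action_closed S.LQ.actions_commute S.QR.actions_commute S.pairing_balanced)
  have \<psi>_sup: "sup_morphism Q (Q1 \<T>) \<psi>"
  proof (rule Q1_sup_morphismI[OF S.Q.complete_lattice_axioms \<psi>_closed])
    show "sup_morphism Q \<L> (\<lambda>q. fst (\<psi> q) l)" if "l \<in> carrier \<L>" for l
      unfolding fst_\<psi>[OF that] by (rule sup_bimorphism_right[OF ra that])
    show "sup_morphism Q \<R> (\<lambda>q. snd (\<psi> q) r)" if "r \<in> carrier \<R>" for r
      unfolding snd_\<psi>[OF that] by (rule sup_bimorphism_left[OF la that])
  qed
  have "\<psi> (p \<cdot>\<^bsub>Q\<^esub> q) = \<psi> p \<cdot>\<^bsub>Q1 \<T>\<^esub> \<psi> q" if p: "p \<in> carrier Q" and q: "q \<in> carrier Q" for p q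
  proof (rule Q1_eqI)
    show "\<psi> (p \<cdot>\<^bsub>Q\<^esub> q) \<in> carrier (Q1 \<T>)"
      by (rule \<psi>_closed[OF sup_bimorphism_closed[OF S.Q.qmult_bimorphism p q]])
    show "\<psi> p \<cdot>\<^bsub>Q1 \<T>\<^esub> \<psi> q \<in> carrier (Q1 \<T>)" using p q by (intro Q1_qmult_closed \<psi>_closed)
  qed (use p q in \<open>simp_all add: Q1_qmult_apply fst_\<psi> snd_\<psi> la_closed ra_closed
      S.QR.left.left_action_assoc S.LQ.right.right_action_assoc\<close>)
  with \<psi>_sup have \<psi>: "quantale_morphism Q (Q1 \<T>) \<psi>" by (simp add: quantale_morphism_def)
  obtain \<phi>0 where \<phi>0: "sup_morphism (Q0 \<T>) Q \<phi>0"
    "\<And>r l. \<lbrakk>r \<in> carrier \<R>; l \<in> carrier \<L>\<rbrakk> \<Longrightarrow> \<phi>0 (r \<otimes> l) = rl r l"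
    using Q0_lift[OF S.rl_bimorphism S.rl_balanced] by blast
  have factor: "\<psi> (\<phi>0 c) = \<phi> c" if c: "c \<in> carrier (Q0 \<T>)" for c
  proof (rule Q0_eqI[OF sup_morphism_comp[OF \<psi>_sup \<phi>0(1)] coupling_sup_morphism _ c])
    fix r l assume rl: "r \<in> carrier \<R>" "l \<in> carrier \<L>"
    show "\<psi> (\<phi>0 (r \<otimes> l)) = \<phi> (r \<otimes> l)"
      unfolding \<phi>0(2)[OF rl] coupling_tensor[OF rl]
      by (rule Q1_eqI[OF \<psi>_closed[OF rl_closed[OF rl]] rank_one_closed[OF rl]])
        (simp_all add: fst_\<psi> snd_\<psi> rank_one_apply rl S.rl_act_R S.rl_act_L)
  qed
  have couple: "couple (Q0 \<T>) Q (\<lambda>k c. \<psi> k \<bullet> c) (\<lambda>c k. c \<star> \<psi> k) \<phi>0"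
    by (rule restricted_couple[OF S.Q.quantale_axioms \<psi> \<phi>0(1) factor])
      (simp_all only: fst_\<psi> snd_\<psi> \<phi>0(2) la_closed ra_closed S.rl_left S.rl_right)
  then interpret C: couple "Q0 \<T>" Q "\<lambda>k c. \<psi> k \<bullet> c" "\<lambda>c k. c \<star> \<psi> k" \<phi>0 .
  show ?thesis
    unfolding couple_factorization_def
    using S.Q.quantale_axioms C.coupling_quantale_morphism \<psi> factor couple by blast
qed

text \<open>The same dictionary read backwards: linearity and adjointness inside \<open>Q1\<close>
  supply the bimodule laws and \<open>pairing_balanced\<close>, and the coupling conditions become
  the laws of the product \<open>r l\<close> when evaluated at tensors.\<close>

lemma factorization_solution:
  assumes "couple_factorization (Q0 \<T>) (Q1 \<T>) (Q0_left_act \<T>) (Q0_right_act \<T>) \<phi> Q \<phi>0 \<phi>1"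
  shows "triad_solution \<T> Q (\<lambda>q r. snd (\<phi>1 q) r) (\<lambda>l q. fst (\<phi>1 q) l) (\<lambda>r l. \<phi>0 (r \<otimes> l))"
proof -
  have Q: "quantale Q" and \<phi>1: "quantale_morphism Q (Q1 \<T>) \<phi>1"
    and factor: "\<And>c. c \<in> carrier (Q0 \<T>) \<Longrightarrow> \<phi>1 (\<phi>0 c) = \<phi> c"
    and couple: "couple (Q0 \<T>) Q (\<lambda>k c. \<phi>1 k \<bullet> c) (\<lambda>c k. c \<star> \<phi>1 k) \<phi>0"
    using assms by (simp_all add: couple_factorization_def)
  interpret C: couple "Q0 \<T>" Q "\<lambda>k c. \<phi>1 k \<bullet> c" "\<lambda>c k. c \<star> \<phi>1 k" \<phi>0 by fact
  have \<phi>1_sup: "sup_morphism Q (Q1 \<T>) \<phi>1"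
    and \<phi>1_mult: "\<And>p q. \<lbrakk>p \<in> carrier Q; q \<in> carrier Q\<rbrakk> \<Longrightarrow> \<phi>1 (p \<cdot>\<^bsub>Q\<^esub> q) = \<phi>1 p \<cdot>\<^bsub>Q1 \<T>\<^esub> \<phi>1 q"
    using \<phi>1 by (simp_all add: quantale_morphism_def)
  have \<phi>1_closed: "\<phi>1 q \<in> carrier (Q1 \<T>)" if "q \<in> carrier Q" for q
    using \<phi>1_sup that by (rule sup_morphism_closed)
  have \<phi>0_sup: "sup_morphism (Q0 \<T>) Q \<phi>0"
    and left: "\<And>q c. \<lbrakk>q \<in> carrier Q; c \<in> carrier (Q0 \<T>)\<rbrakk> \<Longrightarrow> \<phi>0 (\<phi>1 q \<bullet> c) = q \<cdot>\<^bsub>Q\<^esub> \<phi>0 c"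
    using C.coupling_left_morphism by (simp_all add: left_module_morphism_def)
  have right: "\<And>q c. \<lbrakk>q \<in> carrier Q; c \<in> carrier (Q0 \<T>)\<rbrakk> \<Longrightarrow> \<phi>0 (c \<star> \<phi>1 q) = \<phi>0 c \<cdot>\<^bsub>Q\<^esub> q"
    using C.coupling_right_morphism by (simp add: right_module_morphism_def)
  have la: "sup_bimorphism Q \<R> \<R> (\<lambda>q r. snd (\<phi>1 q) r)"
  proof (rule sup_bimorphismI)
    show "sup_morphism Q \<R> (\<lambda>q. snd (\<phi>1 q) r)" if "r \<in> carrier \<R>" for r
      by (rule sup_morphism_comp[OF Q1_snd_sup_morphism[OF that] \<phi>1_sup])
    show "sup_morphism \<R> \<R> (\<lambda>r. snd (\<phi>1 q) r)" if "q \<in> carrier Q" for q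
      by (rule Q1_sup_morphism(2)[OF \<phi>1_closed[OF that]])
  qed
  have ra: "sup_bimorphism \<L> Q \<L> (\<lambda>l q. fst (\<phi>1 q) l)"
  proof (rule sup_bimorphismI)
    show "sup_morphism Q \<L> (\<lambda>q. fst (\<phi>1 q) l)" if "l \<in> carrier \<L>" for l
      by (rule sup_morphism_comp[OF Q1_fst_sup_morphism[OF that] \<phi>1_sup])
    show "sup_morphism \<L> \<L> (\<lambda>l. fst (\<phi>1 q) l)" if "q \<in> carrier Q" for q
      by (rule Q1_sup_morphism(1)[OF \<phi>1_closed[OF that]])
  qed
  \<comment> \<open>The product \<open>r l\<close> acts as the rank-one pair; its two components are
    the last two axioms of a solution.\<close>
  have \<phi>1_\<phi>0: "\<phi>1 (\<phi>0 (r \<otimes> l)) = rank_one r l" if "r \<in> carrier \<R>" "l \<in> carrier \<L>" for r l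
    using factor[OF tensor_closed[OF that]] coupling_tensor[OF that] by simp
  show ?thesis
  proof
    show "sup_bimorphism Q \<R> \<R> (\<lambda>q r. snd (\<phi>1 q) r)" by fact
    show "sup_bimorphism \<L> Q \<L> (\<lambda>l q. fst (\<phi>1 q) l)" by fact
    show "sup_bimorphism \<R> \<L> Q (\<lambda>r l. \<phi>0 (r \<otimes> l))"
      by (rule sup_bimorphism_comp[OF \<phi>0_sup tensor_bimorphism])
    show "snd (\<phi>1 (p \<cdot>\<^bsub>Q\<^esub> q)) r = snd (\<phi>1 p) (snd (\<phi>1 q) r)"
      if "p \<in> carrier Q" "q \<in> carrier Q" "r \<in> carrier \<R>" for p q r
      using that by (simp add: \<phi>1_mult Q1_qmult_apply)
    show "fst (\<phi>1 (p \<cdot>\<^bsub>Q\<^esub> q)) l = fst (\<phi>1 q) (fst (\<phi>1 p) l)"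
      if "l \<in> carrier \<L>" "p \<in> carrier Q" "q \<in> carrier Q" for p q l
      using that by (simp add: \<phi>1_mult Q1_qmult_apply)
    show "snd (\<phi>1 q) r \<lhd> t = snd (\<phi>1 q) (r \<lhd> t)"
      if "q \<in> carrier Q" "r \<in> carrier \<R>" "t \<in> carrier \<S>" for q r t
      using that by (simp add: \<phi>1_closed Q1_snd_action)
    show "fst (\<phi>1 q) (t \<rhd> l) = t \<rhd> fst (\<phi>1 q) l"
      if "t \<in> carrier \<S>" "l \<in> carrier \<L>" "q \<in> carrier Q" for q t l
      using that by (simp add: \<phi>1_closed Q1_fst_action)
    \<comment> \<open>These are the linearity of \<open>\<phi>0\<close> over scalars restricted
      along \<open>\<phi>1\<close>, taken at \<open>r \<otimes> l\<close>, where the actions on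
      \<open>Q0\<close> are explicit.\<close>
    show "\<phi>0 (snd (\<phi>1 q) r \<otimes> l) = q \<cdot>\<^bsub>Q\<^esub> \<phi>0 (r \<otimes> l)" "\<phi>0 (r \<otimes> l) \<cdot>\<^bsub>Q\<^esub> q = \<phi>0 (r \<otimes> fst (\<phi>1 q) l)"
      if "q \<in> carrier Q" "r \<in> carrier \<R>" "l \<in> carrier \<L>" for q r l
      using that
      by (simp_all only: left[symmetric] right[symmetric] tensor_closed \<phi>1_closed
          Q0_left_act_tensor Q0_right_act_tensor)
    show "\<phi>0 ((r \<lhd> t) \<otimes> l) = \<phi>0 (r \<otimes> (t \<rhd> l))"
      if "r \<in> carrier \<R>" "t \<in> carrier \<S>" "l \<in> carrier \<L>" for r t l
      using that by (simp add: tensor_balanced)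
    show "\<langle>fst (\<phi>1 q) l, r\<rangle> = \<langle>l, snd (\<phi>1 q) r\<rangle>"
      if "l \<in> carrier \<L>" "q \<in> carrier Q" "r \<in> carrier \<R>" for l q r
      using that by (simp add: \<phi>1_closed Q1_adjoint)
    show "snd (\<phi>1 (\<phi>0 (r \<otimes> l))) r' = r \<lhd> \<langle>l, r'\<rangle>"
      if "r \<in> carrier \<R>" "l \<in> carrier \<L>" "r' \<in> carrier \<R>" for r l r'
      using that by (simp add: \<phi>1_\<phi>0 rank_one_apply)
    show "\<langle>l, r\<rangle> \<rhd> l' = fst (\<phi>1 (\<phi>0 (r \<otimes> l'))) l"
      if "l \<in> carrier \<L>" "r \<in> carrier \<R>" "l' \<in> carrier \<L>" for l r l'
      using that by (simp add: \<phi>1_\<phi>0 rank_one_apply)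
  qed
qed

end

text \<open>The unique existence of \<open>\<phi>\<close> ensures that the quantification over all
  extensions of the assignment is not vacuous and speaks of a single map.\<close>

theorem theorem3p7:
  fixes \<T> :: "('l, 't, 'r) triad"
  assumes "triad \<T>"
  shows "(\<exists>!\<phi>. extends_triad_assignment \<T> \<phi>) \<and>
    (\<forall>\<phi>. extends_triad_assignment \<T> \<phi> \<longrightarrow>
       unital_couple (Q0 \<T>) (Q1 \<T>) (Q0_left_act \<T>) (Q0_right_act \<T>) \<phi> \<and>
       (\<forall>Q :: 'q quantale. quantale Q \<longrightarrow>
          (is_triad_solution \<T> Q \<longleftrightarrow>
           (\<exists>\<phi>0 \<phi>1. couple_factorization (Q0 \<T>) (Q1 \<T>) (Q0_left_act \<T>) (Q0_right_act \<T>) \<phi>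
                        Q \<phi>0 \<phi>1))))"
proof (intro conjI allI impI)
  interpret triad \<T> by fact
  show "\<exists>!\<phi>. extends_triad_assignment \<T> \<phi>" by (rule extends_triad_assignment_ex1)
  fix \<phi> assume "extends_triad_assignment \<T> \<phi>"
  then interpret triad_coupling \<T> \<phi> by unfold_locales
  show "unital_couple (Q0 \<T>) (Q1 \<T>) (Q0_left_act \<T>) (Q0_right_act \<T>) \<phi>"
    by (rule triad_unital_couple)
  fix Q :: "'q quantale"
  show "is_triad_solution \<T> Q \<longleftrightarrow>
    (\<exists>\<phi>0 \<phi>1. couple_factorization (Q0 \<T>) (Q1 \<T>) (Q0_left_act \<T>) (Q0_right_act \<T>) \<phi> Q \<phi>0 \<phi>1)"
    unfolding is_triad_solution_def using solution_factorization factorization_solution by blast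
qed

end
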